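(* Let $\{M, a_{ij}(x), b_i(x), g(x), K(x,y)\}$ be a Finsleroid-regular space, i.e. $M$ is an $N$-dimensional $C^\infty$ manifold with a Riemannian metric $a_{ij}(x)$, a 1-form $b=b_i(x)y^i$ whose Riemannian norm $c(x)=\sqrt{a^{ij}b_ib_j}$ satisfies $0<c(x)<1$ at every point, a scalar field $g(x)$ with $-2<g(x)<2$ and $g(x)\neq0$, and the Finsler metric function $K$ is the one built from these data in the context. Let $G^i=\gamma^i{}_{nm}y^ny^m$ be the spray coefficients of $K$. Then the equality $$G^i=a^i{}_{nm}y^ny^m$$ holds (for all $x\in M$ and all $y\in T_xM\setminus\{0\}$) if and only if $$g=\text{const}\quad(\text{i.e. }\partial g/\partial x^i=0\text{ on }M)\qquad\text{and}\qquad\nabla_mb_n=0 .$$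
   Context: Setting. $M$ is an $N$-dimensional $C^\infty$ manifold with local coordinates $x^i$ and tangent vectors $y=(y^i)\in T_xM\setminus\{0\}$; $a_{ij}(x)$ is a Riemannian metric with inverse $a^{ij}$; $b=b_i(x)y^i$ is a 1-form with $a^{ij}b_ib_j=c^2(x)$, $0<c(x)<1$; $g=g(x)$ is a scalar field with $-2<g(x)<2$ (the Finsleroid charge). All data are smooth. The same letter $b$ denotes the value $b_i(x)y^i$. Metric function. Put $S=\sqrt{a_{ij}y^iy^j}$, $q=\sqrt{S^2-b^2}$ (which is positive for $y\neq0$ because $c<1$), $h=\sqrt{1-g^2/4}$, $G=g/h$ (this $G$, without index, is not a spray coefficient), $L=q+\frac g2 b$, and $$B=b^2+gqb+q^2 .$$ The Finsleroid-regular metric function is $$K(x,y)=\sqrt{B}\,e^{-\frac12 G f},$$ where $f=-\arctan\frac G2+\arctan\frac{L}{hb}$ if $b\ge0$, and $f=\pi-\arctan\frac G2+\arctan\frac{L}{hb}$ if $b\le0$ (at $b=0$ the value is the common limit $f=\frac\pi2-\arctan\frac G2$). Finslerian objects. $g_{ij}=\frac12\,\partial^2K^2/\partial y^i\partial y^j$ with inverse $g^{ij}$; $\gamma^i{}_{nm}=\frac12 g^{ij}(\partial_{x^m}g_{jn}+\partial_{x^n}g_{jm}-\partial_{x^j}g_{nm})$ are the Finslerian Christoffel symbols; the spray coefficients are $G^i=\gamma^i{}_{nm}y^ny^m$ (no factor $\frac12$). Riemannian objects. $a^k{}_{ij}=\frac12a^{kn}(\partial_ja_{ni}+\partial_ia_{nj}-\partial_na_{ji})$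 are the Christoffel symbols of $a_{ij}$, and $\nabla_ib_j=\partial_ib_j-b_ka^k{}_{ij}$ is the Riemannian covariant derivative. *)

theory Defs
  imports "HOL-Analysis.Analysis"
begin

text \<open>For open \<open>U\<close> this is the usual class of \<open>k\<close> times continuously differentiable functions.\<close>

fun C_k_on :: "nat \<Rightarrow> ('a::real_normed_vector \<Rightarrow> 'b::real_normed_vector) \<Rightarrow> 'a set \<Rightarrow> bool" where
  "C_k_on 0 F U \<longleftrightarrow> continuous_on U F"
| "C_k_on (Suc k) F U \<longleftrightarrow>
     (\<forall>x\<in>U. F differentiable (at x)) \<and> (\<forall>v. C_k_on k (\<lambda>x. frechet_derivative F (at x) v) U)"

definition smooth_on :: "'a set \<Rightarrow> ('a::real_normed_vector \<Rightarrow> 'b::real_normed_vector) \<Rightarrow> bool" where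
  "smooth_on U F \<longleftrightarrow> (\<forall>k. C_k_on k F U)"

definition pderiv_at :: "'n::finite \<Rightarrow> (real^'n \<Rightarrow> real) \<Rightarrow> real^'n \<Rightarrow> real" where
  "pderiv_at i F x = deriv (\<lambda>t. F (x + t *\<^sub>R axis i 1)) 0"

text \<open>A chart is a domain together with a coordinate map; the values of the map outside the
  domain are irrelevant. The dimension is the cardinality of the index type \<open>'n\<close>.\<close>

type_synonym ('p, 'n) chart = "'p set \<times> ('p \<Rightarrow> real^'n)"

definition cdom :: "('p, 'n) chart \<Rightarrow> 'p set" where
  "cdom c = fst c"

definition coord :: "('p, 'n) chart \<Rightarrow> 'p \<Rightarrow> real^'n" where
  "coord c = snd c"

definition cpoint :: "('p, 'n) chart \<Rightarrow> real^'n \<Rightarrow> 'p" where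
  "cpoint c = inv_into (cdom c) (coord c)"

definition crange :: "('p, 'n) chart \<Rightarrow> (real^'n) set" where
  "crange c = coord c ` cdom c"

definition transition :: "('p, 'n) chart \<Rightarrow> ('p, 'n) chart \<Rightarrow> real^'n \<Rightarrow> real^'n" where
  "transition c c' = coord c' \<circ> cpoint c"

locale smooth_manifold =
  fixes X :: "'p topology" and A :: "('p, 'n::finite) chart set"
  assumes Hausdorff: "Hausdorff_space X"
    and second_countable: "second_countable X"
    and chart_open: "\<And>c. c \<in> A \<Longrightarrow> openin X (cdom c) \<and> open (crange c)"
    and chart_homeomorphic:
      "\<And>c. c \<in> A \<Longrightarrow>
        homeomorphic_map (subtopology X (cdom c)) (top_of_set (crange c)) (coord c)"
    and charts_cover: "(\<Union>c\<in>A. cdom c) = topspace X"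
    and transition_smooth:
      "\<And>c c'. c \<in> A \<Longrightarrow> c' \<in> A \<Longrightarrow>
        smooth_on (coord c ` (cdom c \<inter> cdom c')) (transition c c')"

definition christoffel_R ::
    "(real^'n::finite \<Rightarrow> real^'n^'n) \<Rightarrow> real^'n \<Rightarrow> 'n \<Rightarrow> 'n \<Rightarrow> 'n \<Rightarrow> real" where
  "christoffel_R a x k i j =
     1/2 * (\<Sum>n\<in>UNIV. matrix_inv (a x) $ k $ n *
       (pderiv_at j (\<lambda>z. a z $ n $ i) x + pderiv_at i (\<lambda>z. a z $ n $ j) x
        - pderiv_at n (\<lambda>z. a z $ j $ i) x))"

definition nabla ::
    "(real^'n::finite \<Rightarrow> real^'n^'n) \<Rightarrow> (real^'n \<Rightarrow> real^'n) \<Rightarrow> real^'n \<Rightarrow> 'n \<Rightarrow> 'n \<Rightarrow> real" where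
  "nabla a b x i j =
     pderiv_at i (\<lambda>z. b z $ j) x - (\<Sum>k\<in>UNIV. b x $ k * christoffel_R a x k i j)"

definition covector_norm :: "real^'n^'n \<Rightarrow> real^'n::finite \<Rightarrow> real" where
  "covector_norm \<alpha> \<beta> = sqrt (\<Sum>i\<in>UNIV. \<Sum>j\<in>UNIV. matrix_inv \<alpha> $ i $ j * \<beta> $ i * \<beta> $ j)"

text \<open>Here \<open>K x y\<close> is the value of the metric function at the point \<open>x\<close> on the tangent vector \<open>y\<close>.\<close>

definition finsler_metric ::
    "(real^'n::finite \<Rightarrow> real^'n \<Rightarrow> real) \<Rightarrow> real^'n \<Rightarrow> real^'n \<Rightarrow> real^'n^'n" where
  "finsler_metric K x y =
     (\<chi> i j. 1/2 * pderiv_at i (\<lambda>v. pderiv_at j (\<lambda>u. (K x u)\<^sup>2) v) y)"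

definition christoffel_F ::
    "(real^'n::finite \<Rightarrow> real^'n \<Rightarrow> real) \<Rightarrow> real^'n \<Rightarrow> real^'n \<Rightarrow> 'n \<Rightarrow> 'n \<Rightarrow> 'n \<Rightarrow> real" where
  "christoffel_F K x y i n m =
     1/2 * (\<Sum>j\<in>UNIV. matrix_inv (finsler_metric K x y) $ i $ j *
       (pderiv_at m (\<lambda>z. finsler_metric K z y $ j $ n) x
        + pderiv_at n (\<lambda>z. finsler_metric K z y $ j $ m) x
        - pderiv_at j (\<lambda>z. finsler_metric K z y $ n $ m) x))"

text \<open>No factor \<open>1/2\<close> in the spray coefficients.\<close>

definition spray ::
    "(real^'n::finite \<Rightarrow> real^'n \<Rightarrow> real) \<Rightarrow> real^'n \<Rightarrow> real^'n \<Rightarrow> 'n \<Rightarrow> real" where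
  "spray K x y i = (\<Sum>n\<in>UNIV. \<Sum>m\<in>UNIV. christoffel_F K x y i n m * y $ n * y $ m)"

text \<open>In the following, \<open>\<alpha>\<close>, \<open>\<beta>\<close>, \<open>g\<close> are the values of \<open>a\<^sub>i\<^sub>j\<close>, \<open>b\<^sub>i\<close> and the charge at one point and
  real arguments \<open>b\<close> stand for the value of the 1-form on the tangent vector \<open>y\<close>.\<close>

definition fin_b :: "real^'n::finite \<Rightarrow> real^'n \<Rightarrow> real" where
  "fin_b \<beta> y = (\<Sum>i\<in>UNIV. \<beta> $ i * y $ i)"

definition fin_S :: "real^'n^'n \<Rightarrow> real^'n::finite \<Rightarrow> real" where
  "fin_S \<alpha> y = sqrt (\<Sum>i\<in>UNIV. \<Sum>j\<in>UNIV. \<alpha> $ i $ j * y $ i * y $ j)"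

definition fin_q :: "real^'n^'n \<Rightarrow> real^'n::finite \<Rightarrow> real^'n \<Rightarrow> real" where
  "fin_q \<alpha> \<beta> y = sqrt ((fin_S \<alpha> y)\<^sup>2 - (fin_b \<beta> y)\<^sup>2)"

definition fin_h :: "real \<Rightarrow> real" where
  "fin_h g = sqrt (1 - g\<^sup>2 / 4)"

definition fin_G :: "real \<Rightarrow> real" where
  "fin_G g = g / fin_h g"

definition fin_L :: "real \<Rightarrow> real \<Rightarrow> real \<Rightarrow> real" where
  "fin_L g b q = q + g/2 * b"

definition fin_B :: "real \<Rightarrow> real \<Rightarrow> real \<Rightarrow> real" where
  "fin_B g b q = b\<^sup>2 + g * q * b + q\<^sup>2"

text \<open>The value at \<open>b = 0\<close> is the common limit of the two branches (for \<open>q > 0\<close>); it has to be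
  given separately because division by zero is \<open>0\<close> here.\<close>

definition fin_f :: "real \<Rightarrow> real \<Rightarrow> real \<Rightarrow> real" where
  "fin_f g b q =
     (if b > 0 then - arctan (fin_G g / 2) + arctan (fin_L g b q / (fin_h g * b))
      else if b < 0 then pi - arctan (fin_G g / 2) + arctan (fin_L g b q / (fin_h g * b))
      else pi/2 - arctan (fin_G g / 2))"

definition fin_K :: "real^'n^'n \<Rightarrow> real^'n::finite \<Rightarrow> real \<Rightarrow> real^'n \<Rightarrow> real" where
  "fin_K \<alpha> \<beta> g y =
     (let b = fin_b \<beta> y; q = fin_q \<alpha> \<beta> y
      in sqrt (fin_B g b q) * exp (- 1/2 * fin_G g * fin_f g b q))"

text \<open>The tensor fields \<open>a\<close> and \<open>b\<close> are given by their components \<open>a c x\<close>, \<open>b c x\<close> in each chart \<open>c\<close>,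
  as functions of the coordinates \<open>x\<close>, subject to the transformation law of covariant tensors;
  the charge \<open>g\<close> is a function on the manifold.\<close>

locale finsleroid_regular_space = smooth_manifold X A
  for X :: "'p topology" and A :: "('p, 'n::finite) chart set" +
  fixes a :: "('p, 'n) chart \<Rightarrow> real^'n \<Rightarrow> real^'n^'n"
    and b :: "('p, 'n) chart \<Rightarrow> real^'n \<Rightarrow> real^'n"
    and g :: "'p \<Rightarrow> real"
  assumes a_smooth: "\<And>c i j. c \<in> A \<Longrightarrow> smooth_on (crange c) (\<lambda>x. a c x $ i $ j)"
    and a_symmetric: "\<And>c x. c \<in> A \<Longrightarrow> x \<in> crange c \<Longrightarrow> transpose (a c x) = a c x"
    and a_positive: "\<And>c x v. c \<in> A \<Longrightarrow> x \<in> crange c \<Longrightarrow> v \<noteq> 0 \<Longrightarrow> v \<bullet> (a c x *v v) > 0"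
    and a_transform:
      "\<And>c c' p. c \<in> A \<Longrightarrow> c' \<in> A \<Longrightarrow> p \<in> cdom c \<inter> cdom c' \<Longrightarrow>
        a c (coord c p) =
          transpose (jacobian (transition c c') (at (coord c p))) ** a c' (coord c' p)
            ** jacobian (transition c c') (at (coord c p))"
    and b_smooth: "\<And>c i. c \<in> A \<Longrightarrow> smooth_on (crange c) (\<lambda>x. b c x $ i)"
    and b_transform:
      "\<And>c c' p. c \<in> A \<Longrightarrow> c' \<in> A \<Longrightarrow> p \<in> cdom c \<inter> cdom c' \<Longrightarrow>
        b c (coord c p) =
          transpose (jacobian (transition c c') (at (coord c p))) *v b c' (coord c' p)"
    and b_norm:
      "\<And>c x. c \<in> A \<Longrightarrow> x \<in> crange c \<Longrightarrow>
        0 < covector_norm (a c x) (b c x) \<and> covector_norm (a c x) (b c x) < 1"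
    and g_smooth: "\<And>c. c \<in> A \<Longrightarrow> smooth_on (crange c) (g \<circ> cpoint c)"
    and g_range: "\<And>p. p \<in> topspace X \<Longrightarrow> -2 < g p \<and> g p < 2"

definition finsleroid_K ::
    "(('p, 'n::finite) chart \<Rightarrow> real^'n \<Rightarrow> real^'n^'n) \<Rightarrow> (('p, 'n) chart \<Rightarrow> real^'n \<Rightarrow> real^'n) \<Rightarrow>
     ('p \<Rightarrow> real) \<Rightarrow> ('p, 'n) chart \<Rightarrow> real^'n \<Rightarrow> real^'n \<Rightarrow> real" where
  "finsleroid_K a b g c x y = fin_K (a c x) (b c x) (g (cpoint c x)) y"

end

theory Submission
  imports Defs
begin

text \<open>Write \<open>A = K\<^sup>2 / B = exp (- G f)\<close>. For \<open>q > 0\<close> the piecewise defined \<open>f\<close> is the angle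
  \<open>pi/2 - arctan ((b + g q / 2) / (h q))\<close> in \<open>(0, pi)\<close> (lemma \<open>fin_f_eq\<close>), so \<open>A\<close> is differentiable in
  \<open>(g, b, q)\<close>, with \<open>dA = A ((g / B) (q db - b dq) + w dg)\<close>. Hence the covector
  \<open>p\<^sub>i = \<partial>(K\<^sup>2/2)/\<partial>y\<^sup>i = A (g q b\<^sub>i + a\<^sub>i\<^sub>j y\<^sup>j)\<close> and the fundamental tensor, which is positive definite
  (lemma \<open>form_positive\<close>), are algebraic in \<open>A\<close>, \<open>g\<close>, \<open>b\<close>, \<open>q\<close>.

  By Euler's identities, lowering the index of the spray coefficients gives
  \<open>g\<^sub>i\<^sub>j G\<^sup>j = y\<^sup>m \<partial>\<^sub>m p\<^sub>i - \<partial>\<^sub>i (K\<^sup>2/2)\<close>. When the Riemannian coefficients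
  \<open>N\<^sup>j = a\<^sup>j\<^sub>n\<^sub>m y\<^sup>n y\<^sup>m\<close> are subtracted from \<open>G\<^sup>j\<close>, all derivatives of \<open>a\<^sub>i\<^sub>j\<close> cancel, and
  \<open>g\<^sub>i\<^sub>j (G\<^sup>j - N\<^sup>j)\<close> becomes a linear expression in \<open>\<nabla>\<^sub>m b\<^sub>n y\<^sup>m y\<^sup>n\<close>, in
  \<open>y\<^sup>m (\<nabla>\<^sub>m b\<^sub>i - \<nabla>\<^sub>i b\<^sub>m)\<close> and in the derivatives of \<open>g\<close> (lemma \<open>spray_difference\<close>). If
  \<open>\<nabla>b = 0\<close> and \<open>dg = 0\<close>, it vanishes, and \<open>G\<^sup>j = N\<^sup>j\<close> because \<open>g\<^sub>i\<^sub>j\<close> is invertible.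

  Conversely, if \<open>G\<^sup>j = N\<^sup>j\<close> for all \<open>y\<close>, contraction with \<open>y\<^sup>i\<close> gives
  \<open>g q \<nabla>\<^sub>m b\<^sub>n y\<^sup>m y\<^sup>n + (P / 2) y\<^sup>m \<partial>\<^sub>m g = 0\<close>, where \<open>P = w B + q b\<close> is the derivative of \<open>K\<^sup>2\<close> with
  respect to \<open>g\<close>, up to the factor \<open>A\<close>. The decisive fact is that \<open>P < 0\<close> for every \<open>y\<close> (lemma
  \<open>fin_w_negative\<close>). The first term is even in \<open>y\<close> and \<open>y\<^sup>m \<partial>\<^sub>m g\<close> is odd, so comparing \<open>y\<close> with \<open>- y\<close>
  gives \<open>(P(y) + P(-y)) y\<^sup>m \<partial>\<^sub>m g = 0\<close>, hence \<open>dg = 0\<close>. As \<open>g \<noteq> 0\<close>, the symmetric part of \<open>\<nabla>b\<close> vanishes;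
  what is left of the uncontracted equation is \<open>A g q y\<^sup>m (\<nabla>\<^sub>m b\<^sub>i - \<nabla>\<^sub>i b\<^sub>m) = 0\<close>, so the skew part
  vanishes too. The whole argument takes place at one point of one chart.\<close>

section \<open>The metric function in the variables \<open>b\<close>, \<open>q\<close>\<close>

lemma fin_h_squared: "-2 < g \<Longrightarrow> g < 2 \<Longrightarrow> (fin_h g)\<^sup>2 = 1 - g\<^sup>2 / 4"
  using power_mono[of "\<bar>g\<bar>" 2 2] by (simp add: fin_h_def)

lemma fin_h_pos:
  assumes "-2 < g" "g < 2"
  shows "0 < fin_h g"
proof -
  have "g\<^sup>2 < 4"
    using abs_square_less_1[of "g/2"] assms by (simp add: power_divide)
  then show ?thesis by (simp add: fin_h_def)
qed

lemma fin_B_sum_squares: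
  assumes "-2 < g" "g < 2"
  shows "fin_B g b q = (b + g * q / 2)\<^sup>2 + (fin_h g * q)\<^sup>2"
proof -
  have "(fin_h g * q)\<^sup>2 = (1 - g\<^sup>2 / 4) * q\<^sup>2"
    using fin_h_squared[OF assms] by (simp add: power_mult_distrib)
  then show ?thesis
    by (simp add: fin_B_def field_simps power2_eq_square)
qed

lemma fin_B_pos:
  assumes "-2 < g" "g < 2" "0 < q"
  shows "0 < fin_B g b q"
  using fin_h_pos[OF assms(1,2)] assms(3)
  by (simp add: fin_B_sum_squares[OF assms(1,2)] add_nonneg_pos)

lemma arctan_diff_greater:
  assumes "s < r"
  shows "arctan r - arctan s = pi/2 - arctan ((1 + r * s) / (r - s))"
proof -
  let ?d = "arctan r - arctan s"
  have bounds: "0 < ?d" "?d < pi"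
    using assms arctan_bounded[of r] arctan_bounded[of s] by (auto simp: arctan_less_iff)
  define u v where "u = sqrt (1 + r\<^sup>2)" and "v = sqrt (1 + s\<^sup>2)"
  have uv: "u > 0" "v > 0"
    by (simp_all add: u_def v_def add_pos_nonneg)
  have "cos ?d = (1 + r * s) / (u * v)" "sin ?d = (r - s) / (u * v)"
    using uv by (simp_all add: cos_diff sin_diff cos_arctan sin_arctan u_def v_def diff_divide_distrib add_divide_distrib)
  then have "tan (pi/2 - ?d) = (1 + r * s) / (r - s)"
    using uv by (simp add: tan_cot' cot_def)
  then have "arctan ((1 + r * s) / (r - s)) = pi/2 - ?d"
    using bounds by (intro arctan_unique) auto
  then show ?thesis by simp
qed

text \<open>The three branches of \<open>f\<close> are one smooth expression on the half-plane \<open>q > 0\<close>.\<close>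

lemma fin_f_eq:
  assumes "-2 < g" "g < 2" "0 < q"
  shows "fin_f g b q = pi/2 - arctan ((b + g * q / 2) / (fin_h g * q))"
proof -
  define h where "h = fin_h g"
  have h: "h > 0" "h\<^sup>2 = 1 - g\<^sup>2/4"
    using fin_h_pos[OF assms(1,2)] fin_h_squared[OF assms(1,2)] by (auto simp: h_def)
  define r s where "r = (q + g/2 * b) / (h * b)" and "s = g / h / 2"
  have quot: "(1 + r * s) / (r - s) = (b + g * q / 2) / (h * q)" and diff: "r - s = q / (h * b)"
    if "b \<noteq> 0"
  proof -
    show d: "r - s = q / (h * b)"
      using that h(1) by (simp add: r_def s_def field_simps)
    have "h\<^sup>2 * b * (1 + r * s) = h\<^sup>2 * b + (q + g/2 * b) * g / 2"
      using that h(1) by (simp add: r_def s_def field_simps power2_eq_square)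
    also have "\<dots> = b + g * q / 2"
      unfolding h(2) by (simp add: field_simps power2_eq_square)
    finally have n: "1 + r * s = (b + g * q / 2) / (h\<^sup>2 * b)"
      using that h(1) by (simp add: field_simps)
    then show "(1 + r * s) / (r - s) = (b + g * q / 2) / (h * q)"
      unfolding d n using that h(1) assms(3) by (simp add: field_simps power2_eq_square)
  qed
  consider "b > 0" | "b = 0" | "b < 0" by linarith
  then show ?thesis
  proof cases
    case 1
    then have "s < r"
      using diff h(1) assms(3) by (metis diff_gt_0_iff_gt divide_pos_pos mult_pos_pos order_less_irrefl)
    from arctan_diff_greater[OF this] quot 1 show ?thesis
      by (simp add: fin_f_def fin_G_def fin_L_def h_def r_def s_def)
  next
    case 2
    then show ?thesis
      using assms(3) by (simp add: fin_f_def fin_G_def mult.commute)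
  next
    case 3
    have "r - s < 0"
      using diff 3 h(1) assms(3) by (simp add: divide_pos_neg mult_pos_neg)
    then have "r < s" by simp
    have "(1 + s * r) / (s - r) = - ((1 + r * s) / (r - s))"
      by (simp add: mult.commute minus_divide_right)
    then have "pi + arctan r - arctan s = pi/2 - arctan ((1 + r * s) / (r - s))"
      using arctan_diff_greater[OF \<open>r < s\<close>] by (simp add: arctan_minus)
    with quot 3 show ?thesis
      by (simp add: fin_f_def fin_G_def fin_L_def h_def r_def s_def)
  qed
qed

text \<open>The quotient \<open>K\<^sup>2 / B\<close>, as a function of the charge, \<open>b\<close> and \<open>q\<close>.\<close>

definition fin_A :: "real \<Rightarrow> real \<Rightarrow> real \<Rightarrow> real" where
  "fin_A g b q = exp (- (fin_G g * fin_f g b q))"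

lemma fin_A_pos: "0 < fin_A g b q"
  by (simp add: fin_A_def)

text \<open>The partial derivative of \<open>ln fin_A\<close> with respect to the charge.\<close>

definition fin_w :: "real \<Rightarrow> real \<Rightarrow> real \<Rightarrow> real" where
  "fin_w g b q =
     g * q * (2 * q + g * b) / (4 * (fin_h g)\<^sup>2 * fin_B g b q) - fin_f g b q / (fin_h g)^3"

lemma fin_K_squared:
  assumes "-2 < g" "g < 2" "0 < fin_q \<alpha> \<beta> y"
  shows "(fin_K \<alpha> \<beta> g y)\<^sup>2 =
    fin_A g (fin_b \<beta> y) (fin_q \<alpha> \<beta> y) * fin_B g (fin_b \<beta> y) (fin_q \<alpha> \<beta> y)"
  using fin_B_pos[OF assms]
  by (simp add: fin_K_def Let_def fin_A_def power_mult_distrib power2_eq_square[of "exp _"]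
      exp_add[symmetric] less_imp_le)

text \<open>Up to a positive factor, the left-hand side is the derivative of \<open>K\<^sup>2\<close> with respect to the
  charge. Since \<open>f\<close> is the angle with \<open>sin f = h q / \<surd>B\<close> and \<open>cos f = (b + g q / 2) / \<surd>B\<close>,
  the inequality says that \<open>sin f cos f < f\<close>.\<close>

lemma fin_w_negative:
  assumes "-2 < g" "g < 2" "0 < q"
  shows "fin_w g b q * fin_B g b q + q * b < 0"
proof -
  define h f B u where "h = fin_h g" and "f = fin_f g b q" and "B = fin_B g b q"
    and "u = (b + g * q / 2) / (h * q)"
  have h: "h > 0" "h\<^sup>2 = 1 - g\<^sup>2/4"
    using fin_h_pos[OF assms(1,2)] fin_h_squared[OF assms(1,2)] by (auto simp: h_def)
  have B: "B > 0"
    using fin_B_pos[OF assms] by (simp add: B_def)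
  have f: "f = pi/2 - arctan u"
    using fin_f_eq[OF assms] by (simp add: f_def u_def h_def)
  have f_pos: "f > 0"
    using arctan_ubound[of u] f by simp
  have u: "h * q * u = b + g * q / 2"
    using h(1) assms(3) by (simp add: u_def)
  have B_u: "B = (h * q)\<^sup>2 * (1 + u\<^sup>2)"
    using fin_B_sum_squares[OF assms(1,2), of b q] u[symmetric]
    by (simp add: B_def h_def algebra_simps power_mult_distrib)
  have "u / (1 + u\<^sup>2) < f"
  proof -
    have r: "sqrt (1 + u\<^sup>2) > 0" "u < sqrt (1 + u\<^sup>2)" "1 + u\<^sup>2 = sqrt (1 + u\<^sup>2) * sqrt (1 + u\<^sup>2)"
      by (auto simp: add_pos_nonneg real_less_rsqrt)
    have "u / (1 + u\<^sup>2) < 1 / sqrt (1 + u\<^sup>2)"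
      using r(1,2) by (subst r(3)) (simp add: field_simps del: real_sqrt_mult_self)
    also have "\<dots> = sin f"
      by (simp add: f sin_diff cos_arctan)
    also have "\<dots> \<le> f"
      using f_pos by (simp add: sin_x_le_x)
    finally show ?thesis .
  qed
  then have "u < f * (1 + u\<^sup>2)"
    by (simp add: pos_divide_less_eq add_pos_nonneg)
  then have "(h * q)\<^sup>2 * u < (h * q)\<^sup>2 * (f * (1 + u\<^sup>2))"
    using h(1) assms(3) by (intro mult_strict_left_mono) auto
  also have "\<dots> = B * f"
    by (simp add: B_u)
  finally have "(h * q)\<^sup>2 * u < B * f" .
  then have less: "h * q * (b + g * q / 2) < B * f"
    by (simp add: u[symmetric] power2_eq_square mult_ac)
  have "fin_w g b q * B + q * b = (g * q * (2 * q + g * b) + 4 * h\<^sup>2 * q * b) / (4 * h\<^sup>2) - B * f / h^3"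
    using B h(1) by (simp add: fin_w_def h_def[symmetric] B_def[symmetric] f_def[symmetric] field_simps)
  also have "g * q * (2 * q + g * b) + 4 * h\<^sup>2 * q * b = 4 * q * (b + g * q / 2)"
    unfolding h(2) by (simp add: field_simps power2_eq_square)
  also have "4 * q * (b + g * q / 2) / (4 * h\<^sup>2) - B * f / h^3 = (h * q * (b + g * q / 2) - B * f) / h^3"
    using h(1) by (simp add: field_simps power2_eq_square power3_eq_cube)
  also have "\<dots> < 0"
    using less h(1) by (simp add: divide_neg_pos)
  finally show ?thesis by (simp add: B_def)
qed

text \<open>In the directions of \<open>b\<close> and \<open>q\<close> the logarithmic differential of \<open>fin_A\<close> is
  \<open>(g / B) (q db - b dq)\<close>; this is what makes all later formulas algebraic. The neighbourhood \<open>U\<close> is needed because the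
  closed form of \<open>f\<close> is valid for \<open>q > 0\<close> only.\<close>

lemma has_derivative_fin_A:
  fixes gg bb qq :: "'a::real_normed_vector \<Rightarrow> real"
  assumes der: "(gg has_derivative g') (at x)" "(bb has_derivative b') (at x)" "(qq has_derivative q') (at x)"
    and U: "open U" "x \<in> U"
    and range: "\<And>z. z \<in> U \<Longrightarrow> -2 < gg z \<and> gg z < 2 \<and> 0 < qq z"
  shows "((\<lambda>z. fin_A (gg z) (bb z) (qq z)) has_derivative
    (\<lambda>v. fin_A (gg x) (bb x) (qq x) *
      (gg x / fin_B (gg x) (bb x) (qq x) * (qq x * b' v - bb x * q' v)
       + fin_w (gg x) (bb x) (qq x) * g' v))) (at x)"
proof -
  define g b q where "g = gg x" and "b = bb x" and "q = qq x"
  define h B where "h = fin_h g" and "B = fin_B g b q"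
  define u where "u = (\<lambda>z. (bb z + gg z * qq z / 2) / (fin_h (gg z) * qq z))"
  note gbq [symmetric] = g_def b_def q_def
  have q: "q > 0" and g: "-2 < g" "g < 2"
    using range[OF U(2)] by (auto simp: gbq)
  have h: "h > 0" "h\<^sup>2 = 1 - g\<^sup>2/4"
    using fin_h_pos[OF g] fin_h_squared[OF g] by (auto simp: h_def)
  have "h * q * u x = b + g * q / 2"
    using h(1) q by (simp add: u_def gbq h_def[symmetric])
  then have B: "B > 0" "B = (h * q)\<^sup>2 * (1 + (u x)\<^sup>2)"
    using fin_B_pos[OF g q, of b] fin_B_sum_squares[OF g, of b q]
    by (simp_all add: B_def h_def[symmetric] algebra_simps flip: power_mult_distrib)
  have dh: "((\<lambda>z. fin_h (gg z)) has_derivative (\<lambda>v. - g * g' v / (4 * h))) (at x)"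
    unfolding fin_h_def using h(1)
    by (auto intro!: derivative_eq_intros der simp: gbq h_def fin_h_def field_simps)
  have dG: "((\<lambda>z. fin_G (gg z)) has_derivative (\<lambda>v. g' v / h^3)) (at x)"
  proof -
    have "g' v / h^3 = (g' v * h - g * (- g * g' v / (4 * h))) / (h * h)" for v
    proof -
      have "g' v * h - g * (- g * g' v / (4 * h)) = g' v * (h\<^sup>2 + g\<^sup>2/4) / h"
        using h(1) by (simp add: field_simps power2_eq_square)
      moreover have "h\<^sup>2 + g\<^sup>2/4 = 1"
        by (simp add: h(2))
      ultimately show ?thesis
        using h(1) by (simp add: power3_eq_cube)
    qed
    then show ?thesis
      unfolding fin_G_def using h(1)
      by (auto intro!: derivative_eq_intros der dh simp: gbq h_def)
  qed
  have du: "(u has_derivative (\<lambda>v. (q * b' v - b * q' v) / (h * q\<^sup>2)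
      + (2 * q + g * b) / (4 * h^3 * q) * g' v)) (at x)"
  proof -
    have "(q * b' v - b * q' v) / (h * q\<^sup>2) + (2 * q + g * b) / (4 * h^3 * q) * g' v
      = ((b' v + (g' v * q + g * q' v) / 2) * (h * q)
         - (b + g * q / 2) * ((- g * g' v / (4 * h)) * q + h * q' v)) / ((h * q) * (h * q))" (is "?l = ?r") for v
    proof -
      have "4 * h^3 * q\<^sup>2 * ?r = 4 * h\<^sup>2 * (q * b' v - b * q' v) + q * g' v * (2 * h\<^sup>2 * q + g * (b + g * q / 2))"
        using h(1) q by (simp add: field_simps power2_eq_square power3_eq_cube)
      also have "\<dots> = 4 * h\<^sup>2 * (q * b' v - b * q' v) + q * g' v * (2 * q + g * b)"
        unfolding h(2) by (simp add: field_simps power2_eq_square)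
      also have "\<dots> = 4 * h^3 * q\<^sup>2 * ?l"
        using h(1) q by (simp add: field_simps power2_eq_square power3_eq_cube)
      finally have "4 * h^3 * q\<^sup>2 * ?r = 4 * h^3 * q\<^sup>2 * ?l" .
      moreover have "4 * h^3 * q\<^sup>2 \<noteq> 0"
        using h(1) q by simp
      ultimately show ?thesis
        using mult_left_cancel by metis
    qed
    then show ?thesis
      unfolding u_def using h(1) q
      by (auto intro!: derivative_eq_intros der dh simp: gbq h_def)
  qed
  define D where "D = (\<lambda>v. (q * b' v - b * q' v) / (h * q\<^sup>2)
      + (2 * q + g * b) / (4 * h^3 * q) * g' v)"
  define ff f where "ff = (\<lambda>z. pi/2 - arctan (u z))" and "f = ff x"
  have df: "(ff has_derivative (\<lambda>v. - (D v * inverse (1 + (u x)\<^sup>2)))) (at x)"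
    unfolding ff_def D_def by (auto intro!: derivative_eq_intros du)
  have dA: "((\<lambda>z. exp (- (fin_G (gg z) * ff z))) has_derivative
    (\<lambda>v. fin_A g b q *
      (g / B * (q * b' v - b * q' v) + fin_w g b q * g' v))) (at x)"
  proof -
    have A: "fin_A g b q = exp (- (fin_G g * f))" and f': "fin_f g b q = f"
      using fin_f_eq[OF g q, of b] by (simp_all add: fin_A_def f_def ff_def u_def gbq)
    have "g / B * (q * b' v - b * q' v) + fin_w g b q * g' v
       = fin_G g * (D v * inverse (1 + (u x)\<^sup>2)) - g' v / h^3 * f" (is "?l = ?r") for v
    proof -
      have "inverse (1 + (u x)\<^sup>2) = (h * q)\<^sup>2 / B"
        unfolding B(2) using h(1) q by (simp add: inverse_eq_divide)
      then have "?r = (g / h) * (D v * ((h * q)\<^sup>2 / B)) - g' v / h^3 * f"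
        by (simp add: fin_G_def h_def)
      also have "\<dots> = ?l"
        unfolding D_def fin_w_def f' B_def[symmetric] h_def[symmetric]
        using B(1) h(1) q by (simp add: field_simps power2_eq_square power3_eq_cube)
      finally show ?thesis by simp
    qed
    moreover have "((\<lambda>z. exp (- (fin_G (gg z) * ff z))) has_derivative
      (\<lambda>v. fin_A g b q * (fin_G g * (D v * inverse (1 + (u x)\<^sup>2)) - g' v / h^3 * f))) (at x)"
      unfolding A
      by (rule derivative_eq_intros df dG refl)+
        (simp add: gbq f_def fun_eq_iff algebra_simps)
    ultimately show ?thesis by simp
  qed
  show ?thesis
    unfolding gbq B_def[symmetric]
  proof (rule has_derivative_transform_within_open[OF dA U])
    show "exp (- (fin_G (gg z) * ff z)) = fin_A (gg z) (bb z) (qq z)" if "z \<in> U" for z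
      using fin_f_eq[of "gg z" "qq z" "bb z"] range[OF that] by (simp add: fin_A_def u_def ff_def)
  qed
qed

section \<open>Positive definite matrices and partial derivatives\<close>

lemma matrix_inv_invertible:
  fixes M :: "real^'n^'n"
  assumes "invertible M"
  shows "M ** matrix_inv M = mat 1" "matrix_inv M ** M = mat 1"
  using assms someI_ex[of "\<lambda>M'. M ** M' = mat 1 \<and> M' ** M = mat 1"]
  by (auto simp: invertible_def matrix_inv_def)

lemma matrix_mult_inv_vector:
  fixes M :: "real^'n^'n"
  assumes "invertible M"
  shows "M *v (matrix_inv M *v v) = v"
  by (simp add: matrix_vector_mul_assoc matrix_inv_invertible[OF assms])

lemma positive_definite_invertible:
  fixes M :: "real^'n^'n"
  assumes "\<And>v. v \<noteq> 0 \<Longrightarrow> v \<bullet> (M *v v) > 0"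
  shows "invertible M"
proof -
  have "v = 0" if "M *v v = 0" for v
    using assms[of v] that by force
  then have "\<exists>N. N ** M = mat 1"
    using matrix_left_invertible_ker[of M] by blast
  then show ?thesis
    by (simp add: invertible_left_inverse)
qed

lemma symmetric_matrix_inner:
  fixes M :: "real^'n^'n"
  assumes "transpose M = M"
  shows "u \<bullet> (M *v v) = v \<bullet> (M *v u)"
  by (metis assms dot_lmul_matrix inner_commute vector_transpose_matrix)

lemma Cauchy_Schwarz_matrix:
  fixes M :: "real^'n^'n"
  assumes sym: "transpose M = M" and pos: "\<And>v. v \<noteq> 0 \<Longrightarrow> v \<bullet> (M *v v) > 0"
  shows "(u \<bullet> (M *v v))\<^sup>2 \<le> (u \<bullet> (M *v u)) * (v \<bullet> (M *v v))"
proof (cases "v = 0")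
  case False
  define t where "t = (u \<bullet> (M *v v)) / (v \<bullet> (M *v v))"
  have p: "v \<bullet> (M *v v) > 0" using pos False by simp
  have "0 \<le> (u - t *\<^sub>R v) \<bullet> (M *v (u - t *\<^sub>R v))"
    using pos[of "u - t *\<^sub>R v"] by (cases "u - t *\<^sub>R v = 0") auto
  also have "\<dots> = u \<bullet> (M *v u) - 2 * t * (u \<bullet> (M *v v)) + t\<^sup>2 * (v \<bullet> (M *v v))"
    using symmetric_matrix_inner[OF sym, of v u]
    by (simp add: matrix_vector_mult_diff_distrib scaleR_matrix_vector_assoc[symmetric]
        matrix_vector_mult_scaleR inner_diff_left inner_diff_right power2_eq_square algebra_simps)
  also have "\<dots> = u \<bullet> (M *v u) - (u \<bullet> (M *v v))\<^sup>2 / (v \<bullet> (M *v v))"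
    using p by (simp add: t_def power2_eq_square field_simps)
  finally show ?thesis
    using p by (simp add: field_simps)
qed simp

lemma pderiv_at_eq:
  assumes "(F has_derivative F') (at x)"
  shows "pderiv_at i F x = F' (axis i 1)"
proof -
  have "((\<lambda>t. F (x + t *\<^sub>R axis i 1)) has_derivative (\<lambda>t. F' (t *\<^sub>R axis i 1))) (at 0)"
    by (rule has_derivative_compose[of "\<lambda>t. x + t *\<^sub>R axis i 1" _ 0 UNIV F F'])
      (use assms in \<open>auto intro!: derivative_eq_intros\<close>)
  moreover have "(\<lambda>t. F' (t *\<^sub>R axis i 1)) = (*) (F' (axis i 1))"
    using linear_scale[OF has_derivative_linear[OF assms]] by (auto simp: fun_eq_iff mult.commute)
  ultimately have "((\<lambda>t. F (x + t *\<^sub>R axis i 1)) has_derivative (*) (F' (axis i 1))) (at 0)"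
    by simp
  then show ?thesis
    unfolding pderiv_at_def by (intro DERIV_imp_deriv) (simp add: has_field_derivative_def)
qed

lemma sum_scaled_axis:
  fixes F :: "real^'n \<Rightarrow> real"
  assumes "bounded_linear F"
  shows "(\<Sum>m\<in>UNIV. y $ m * F (axis m 1)) = F y"
proof -
  interpret bounded_linear F by fact
  have "F (\<Sum>m\<in>UNIV. y $ m *\<^sub>R axis m 1) = (\<Sum>m\<in>UNIV. y $ m * F (axis m 1))"
    by (simp add: sum scaleR)
  moreover have "(\<Sum>m\<in>UNIV. y $ m *\<^sub>R axis m 1) = y"
    by (simp add: vec_eq_iff axis_def if_distrib cong: if_cong)
  ultimately show ?thesis by simp
qed

section \<open>The fundamental tensor\<close>

lemma fin_b_inner: "fin_b \<beta> y = \<beta> \<bullet> y"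
  by (simp add: fin_b_def inner_vec_def)

lemma quadratic_form_sum:
  "(\<Sum>i\<in>UNIV. \<Sum>j\<in>UNIV. M $ i $ j * y $ i * y $ j) = y \<bullet> (M *v y)"
  for M :: "real^'n^'n"
  by (simp add: inner_vec_def matrix_vector_mult_def sum_distrib_left mult_ac)

text \<open>The derivative of \<open>q\<close> at \<open>y\<close> in the direction \<open>v\<close>.\<close>

definition fin_dq :: "real^'n^'n \<Rightarrow> real^'n::finite \<Rightarrow> real^'n \<Rightarrow> real^'n \<Rightarrow> real" where
  "fin_dq \<alpha> \<beta> y v =
     (v \<bullet> (\<alpha> *v y) - fin_b \<beta> y * fin_b \<beta> v) / fin_q \<alpha> \<beta> y"

text \<open>The covector \<open>\<partial>(K\<^sup>2/2)/\<partial>y\<close>.\<close>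

definition fin_momentum :: "real^'n^'n \<Rightarrow> real^'n::finite \<Rightarrow> real \<Rightarrow> real^'n \<Rightarrow> real^'n" where
  "fin_momentum \<alpha> \<beta> g y =
     fin_A g (fin_b \<beta> y) (fin_q \<alpha> \<beta> y) *\<^sub>R
       ((g * fin_q \<alpha> \<beta> y) *\<^sub>R \<beta> + \<alpha> *v y)"

text \<open>The fundamental tensor at \<open>y\<close> as a bilinear form in \<open>u\<close>, \<open>v\<close>, in the form in which it
  arises by differentiating the momentum in the direction \<open>u\<close>.\<close>

definition fin_form ::
    "real^'n^'n \<Rightarrow> real^'n::finite \<Rightarrow> real \<Rightarrow> real^'n \<Rightarrow> real^'n \<Rightarrow> real^'n \<Rightarrow> real" where
  "fin_form \<alpha> \<beta> g y u v =
     (let b = fin_b \<beta>; q = fin_q \<alpha> \<beta> y; dq = fin_dq \<alpha> \<beta> y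
      in fin_A g (b y) q *
        (g / fin_B g (b y) q * (q * b u - b y * dq u) * (g * q * b v + v \<bullet> (\<alpha> *v y))
         + g * dq u * b v + u \<bullet> (\<alpha> *v v)))"

text \<open>The values \<open>\<alpha>\<close>, \<open>\<beta>\<close>, \<open>g\<close> of the three fields at a single point.\<close>

locale finsleroid_datum =
  fixes \<alpha> :: "real^'n^'n::finite" and \<beta> :: "real^'n" and g :: real
  assumes symmetric: "transpose \<alpha> = \<alpha>"
    and positive: "\<And>v. v \<noteq> 0 \<Longrightarrow> v \<bullet> (\<alpha> *v v) > 0"
    and norm_less: "covector_norm \<alpha> \<beta> < 1"
    and charge: "-2 < g" "g < 2"
begin

abbreviation "b y \<equiv> fin_b \<beta> y"
abbreviation "q y \<equiv> fin_q \<alpha> \<beta> y"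
abbreviation "B y \<equiv> fin_B g (b y) (q y)"
abbreviation "A y \<equiv> fin_A g (b y) (q y)"
abbreviation "dq y v \<equiv> fin_dq \<alpha> \<beta> y v"

lemma b_squared_less:
  assumes "y \<noteq> 0"
  shows "(\<beta> \<bullet> y)\<^sup>2 < y \<bullet> (\<alpha> *v y)"
proof -
  \<comment> \<open>the vector dual to \<open>\<beta>\<close>, whose squared length is the square of the covector norm\<close>
  define w where "w = matrix_inv \<alpha> *v \<beta>"
  have w: "\<alpha> *v w = \<beta>"
    using matrix_mult_inv_vector[OF positive_definite_invertible] positive by (auto simp: w_def)
  have "covector_norm \<alpha> \<beta> = sqrt (w \<bullet> (\<alpha> *v w))"
    unfolding w
    by (simp add: covector_norm_def quadratic_form_sum inner_commute w_def)
  then have less: "w \<bullet> (\<alpha> *v w) < 1"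
    using norm_less by simp
  have "(\<beta> \<bullet> y)\<^sup>2 = (w \<bullet> (\<alpha> *v y))\<^sup>2"
    using symmetric_matrix_inner[OF symmetric, of w y] by (simp add: w inner_commute)
  also have "\<dots> \<le> (w \<bullet> (\<alpha> *v w)) * (y \<bullet> (\<alpha> *v y))"
    by (rule Cauchy_Schwarz_matrix[OF symmetric positive])
  also have "\<dots> < 1 * (y \<bullet> (\<alpha> *v y))"
    using less positive[OF assms] by (intro mult_strict_right_mono)
  finally show ?thesis by simp
qed

lemma q_sqrt: "q y = sqrt (y \<bullet> (\<alpha> *v y) - (\<beta> \<bullet> y)\<^sup>2)"
proof -
  have "0 \<le> y \<bullet> (\<alpha> *v y)"
    using positive[of y] by (cases "y = 0") auto
  then show ?thesis
    by (simp add: fin_q_def fin_S_def quadratic_form_sum fin_b_inner)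
qed

lemma q_pos: "y \<noteq> 0 \<Longrightarrow> 0 < q y"
  using b_squared_less by (simp add: q_sqrt)

lemma q_squared: "(q y)\<^sup>2 = y \<bullet> (\<alpha> *v y) - (b y)\<^sup>2"
  using b_squared_less[of y] by (cases "y = 0") (simp_all add: q_sqrt fin_b_inner)

lemma B_pos: "y \<noteq> 0 \<Longrightarrow> 0 < B y"
  using fin_B_pos[OF charge q_pos] .

lemma reverse_direction: "b (- y) = - b y" "q (- y) = q y"
  by (simp_all add: q_sqrt fin_b_inner linear_neg[OF matrix_vector_mul_linear])


lemma q_mult_dq: "y \<noteq> 0 \<Longrightarrow> q y * dq y v = v \<bullet> (\<alpha> *v y) - b y * b v"
  using q_pos[of y] by (simp add: fin_dq_def)

lemma dq_self: "y \<noteq> 0 \<Longrightarrow> dq y y = q y"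
  using q_pos[of y] q_squared[of y] by (simp add: fin_dq_def field_simps power2_eq_square)

lemma has_derivative_b: "(b has_derivative b) F"
proof -
  have "b = (\<lambda>y. \<beta> \<bullet> y)"
    by (simp add: fun_eq_iff fin_b_inner)
  then show ?thesis
    by (simp add: bounded_linear_imp_has_derivative bounded_linear_inner_right)
qed

lemma has_derivative_q:
  assumes "y \<noteq> 0"
  shows "(q has_derivative dq y) (at y)"
proof -
  have "((\<lambda>y. y \<bullet> (\<alpha> *v y) - b y * b y) has_derivative
     (\<lambda>v. (y \<bullet> (\<alpha> *v v) + v \<bullet> (\<alpha> *v y)) - (b y * b v + b v * b y))) (at y)"
    by (intro has_derivative_diff has_derivative_inner has_derivative_mult has_derivative_ident
        has_derivative_b bounded_linear_imp_has_derivative[OF matrix_vector_mul_bounded_linear])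
  moreover have "(y \<bullet> (\<alpha> *v v) + v \<bullet> (\<alpha> *v y)) - (b y * b v + b v * b y)
      = 2 * (v \<bullet> (\<alpha> *v y)) - 2 * b y * b v" for v
    using symmetric_matrix_inner[OF symmetric, of y v] by simp
  ultimately have "((\<lambda>y. y \<bullet> (\<alpha> *v y) - (b y)\<^sup>2) has_derivative
     (\<lambda>v. 2 * (v \<bullet> (\<alpha> *v y)) - 2 * b y * b v)) (at y)"
    by (simp only: power2_eq_square)
  then have "((\<lambda>y. sqrt (y \<bullet> (\<alpha> *v y) - (b y)\<^sup>2)) has_derivative
     (\<lambda>v. (2 * (v \<bullet> (\<alpha> *v y)) - 2 * b y * b v) * (inverse (sqrt (y \<bullet> (\<alpha> *v y) - (b y)\<^sup>2)) / 2))) (at y)"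
    using b_squared_less[OF assms] by (intro has_derivative_real_sqrt) (simp_all add: fin_b_inner)
  moreover have "sqrt (z \<bullet> (\<alpha> *v z) - (b z)\<^sup>2) = q z" for z
    by (simp add: q_sqrt fin_b_inner)
  moreover have "(\<lambda>v. (2 * (v \<bullet> (\<alpha> *v y)) - 2 * b y * b v) * (inverse (q y) / 2)) = dq y"
    using q_pos[OF assms] by (simp add: fun_eq_iff fin_dq_def field_simps)
  ultimately show ?thesis
    by (simp only:)
qed

lemma has_derivative_A:
  assumes "y \<noteq> 0"
  shows "(A has_derivative (\<lambda>v. A y * (g / B y * (q y * b v - b y * dq y v)))) (at y)"
  using has_derivative_fin_A[OF has_derivative_const[of g] has_derivative_b has_derivative_q[OF assms],
      of "- {0}"] assms charge q_pos
  by (simp add: open_Compl)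

lemma momentum_inner:
  "fin_momentum \<alpha> \<beta> g y \<bullet> v = A y * (g * q y * b v + v \<bullet> (\<alpha> *v y))"
  by (simp add: fin_momentum_def fin_b_inner inner_add_left
      inner_commute[of "\<alpha> *v y" v])

lemma has_derivative_K_squared:
  assumes "y \<noteq> 0"
  shows "((\<lambda>y. (fin_K \<alpha> \<beta> g y)\<^sup>2) has_derivative (\<lambda>v. 2 * (fin_momentum \<alpha> \<beta> g y \<bullet> v))) (at y)"
proof -
  have dB: "(B has_derivative (\<lambda>v. 2 * b y * b v + g * (q y * b v + b y * dq y v) + 2 * q y * dq y v)) (at y)"
    unfolding fin_B_def
    by (auto intro!: derivative_eq_intros has_derivative_b has_derivative_q[OF assms] simp: fun_eq_iff algebra_simps)
  have eq: "A y * (2 * b y * b v + g * (q y * b v + b y * dq y v) + 2 * q y * dq y v)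
    + A y * (g / B y * (q y * b v - b y * dq y v)) * B y = 2 * (fin_momentum \<alpha> \<beta> g y \<bullet> v)" for v
  proof -
    have "A y * (g / B y * (q y * b v - b y * dq y v)) * B y = A y * (g * (q y * b v - b y * dq y v))"
      using B_pos[OF assms] by simp
    then have "A y * (2 * b y * b v + g * (q y * b v + b y * dq y v) + 2 * q y * dq y v)
      + A y * (g / B y * (q y * b v - b y * dq y v)) * B y
      = 2 * A y * (g * q y * b v + b y * b v + q y * dq y v)"
      by (simp add: algebra_simps)
    then show ?thesis
      by (simp add: momentum_inner q_mult_dq[OF assms])
  qed
  have "((\<lambda>y. A y * B y) has_derivative (\<lambda>v. 2 * (fin_momentum \<alpha> \<beta> g y \<bullet> v))) (at y)"
    using has_derivative_mult[OF has_derivative_A[OF assms] dB] unfolding eq .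
  then show ?thesis
    by (rule has_derivative_transform_within_open[of _ _ _ UNIV "- {0}"])
      (use assms fin_K_squared[OF charge q_pos] in auto)
qed

lemma has_derivative_momentum:
  assumes "y \<noteq> 0"
  shows "((\<lambda>y. fin_momentum \<alpha> \<beta> g y \<bullet> w) has_derivative (\<lambda>v. fin_form \<alpha> \<beta> g y v w)) (at y)"
  unfolding momentum_inner
  using symmetric_matrix_inner[OF symmetric]
  by (auto intro!: derivative_eq_intros has_derivative_A has_derivative_q assms
      bounded_linear_imp_has_derivative[OF matrix_vector_mul_bounded_linear]
      simp: fun_eq_iff fin_form_def Let_def algebra_simps
        add_divide_distrib diff_divide_distrib)

text \<open>The symmetry of the form becomes visible when \<open>v \<bullet> (\<alpha> *v y)\<close> is replaced by
  \<open>q y * dq y v + b y * b v\<close>.\<close>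

lemma form_eq:
  assumes "y \<noteq> 0"
  shows "fin_form \<alpha> \<beta> g y u v = A y *
    (g / B y * (g * (q y)\<^sup>2 * b u * b v + q y * b y * (b u * b v - dq y u * dq y v)
       + (q y)\<^sup>2 * (b u * dq y v + dq y u * b v)) + u \<bullet> (\<alpha> *v v))"
proof -
  have "(q y * b u - b y * dq y u) * (g * q y * b v + v \<bullet> (\<alpha> *v y)) + B y * (dq y u * b v)
    = g * (q y)\<^sup>2 * b u * b v + q y * b y * (b u * b v - dq y u * dq y v)
       + (q y)\<^sup>2 * (b u * dq y v + dq y u * b v)" (is "?X + B y * ?Y = ?Z")
    using q_mult_dq[OF assms, of v] unfolding fin_B_def by algebra
  moreover have "g / B y * ?X + g * ?Y = g / B y * (?X + B y * ?Y)"
    using B_pos[OF assms] by (simp add: distrib_left)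
  ultimately have "g / B y * ?X + g * ?Y = g / B y * ?Z"
    by simp
  then show ?thesis
    by (simp add: fin_form_def Let_def mult_ac)
qed

lemma form_commute: "y \<noteq> 0 \<Longrightarrow> fin_form \<alpha> \<beta> g y u v = fin_form \<alpha> \<beta> g y v u"
  using symmetric_matrix_inner[OF symmetric, of u v] by (simp add: form_eq algebra_simps)

lemma form_self: "y \<noteq> 0 \<Longrightarrow> fin_form \<alpha> \<beta> g y y v = fin_momentum \<alpha> \<beta> g y \<bullet> v"
  using symmetric_matrix_inner[OF symmetric, of y v]
  by (simp add: fin_form_def momentum_inner Let_def dq_self algebra_simps)

lemma momentum_self: "y \<noteq> 0 \<Longrightarrow> fin_momentum \<alpha> \<beta> g y \<bullet> y = A y * B y"
  using q_squared[of y] by (simp add: momentum_inner fin_B_def)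

text \<open>With \<open>P = dq y v\<close> and \<open>c = b v\<close> the form divided by \<open>A\<close> is bounded from below by a
  quadratic form in \<open>(P, c)\<close>, which is positive definite by completion of the square.\<close>

lemma form_positive:
  assumes "y \<noteq> 0" "v \<noteq> 0"
  shows "0 < fin_form \<alpha> \<beta> g y v v"
proof -
  define P c where "P = dq y v" and "c = b v"
  note pos = q_pos[OF assms(1)] B_pos[OF assms(1)]
  have bound: "P\<^sup>2 + c\<^sup>2 \<le> v \<bullet> (\<alpha> *v v)"
  proof -
    \<comment> \<open>the Cauchy-Schwarz inequality for the quadratic form \<open>q\<^sup>2\<close>\<close>
    define Q where "Q = \<alpha> - (\<chi> i j. \<beta> $ i * \<beta> $ j)"
    have Q: "u \<bullet> (Q *v w) = u \<bullet> (\<alpha> *v w) - b u * b w" for u w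
    proof -
      have "(\<chi> i j. \<beta> $ i * \<beta> $ j) *v w = b w *\<^sub>R \<beta>"
        by (simp add: vec_eq_iff matrix_vector_mult_def fin_b_def sum_distrib_left mult_ac)
      then show ?thesis
        by (simp add: Q_def matrix_vector_mult_diff_rdistrib inner_diff_right fin_b_inner inner_commute)
    qed
    have "transpose Q = Q"
      using symmetric by (simp add: Q_def transpose_def vec_eq_iff mult.commute)
    moreover have "u \<bullet> (Q *v u) > 0" if "u \<noteq> 0" for u
      using b_squared_less[OF that] by (simp add: Q fin_b_inner power2_eq_square)
    ultimately have "(v \<bullet> (Q *v y))\<^sup>2 \<le> (v \<bullet> (Q *v v)) * (y \<bullet> (Q *v y))"
      by (rule Cauchy_Schwarz_matrix)
    also have "y \<bullet> (Q *v y) = (q y)\<^sup>2"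
      using q_squared[of y] by (simp add: Q power2_eq_square)
    also have "v \<bullet> (Q *v y) = q y * P"
      using q_mult_dq[OF assms(1), of v] by (simp add: Q P_def)
    finally have "(q y)\<^sup>2 * P\<^sup>2 \<le> (q y)\<^sup>2 * (v \<bullet> (Q *v v))"
      by (simp add: power_mult_distrib mult.commute)
    then show ?thesis
      using pos by (simp add: Q c_def power2_eq_square)
  qed
  define R where "R = g * (g * (q y)\<^sup>2 * c\<^sup>2 + q y * b y * (c\<^sup>2 - P\<^sup>2) + 2 * (q y)\<^sup>2 * c * P)"
  have form: "fin_form \<alpha> \<beta> g y v v = A y * (R / B y + v \<bullet> (\<alpha> *v v))"
    by (simp add: form_eq[OF assms(1)] R_def P_def[symmetric] c_def[symmetric] power2_eq_square mult_ac)
  have "0 < R / B y + v \<bullet> (\<alpha> *v v)"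
  proof (cases "P = 0 \<and> c = 0")
    case True
    then show ?thesis using positive[OF assms(2)] by (simp add: R_def)
  next
    case False
    \<comment> \<open>\<open>s / B\<close> is the coefficient of \<open>P\<^sup>2\<close> in the quadratic form\<close>
    define s where "s = (b y)\<^sup>2 + (q y)\<^sup>2"
    have s: "s > 0" using pos by (simp add: s_def add_nonneg_pos)
    have square: "s * (R + (P\<^sup>2 + c\<^sup>2) * B y) = (s * P + g * (q y)\<^sup>2 * c)\<^sup>2 + (B y * c)\<^sup>2"
      unfolding s_def R_def fin_B_def by (simp add: power2_eq_square algebra_simps)
    have "0 < (s * P + g * (q y)\<^sup>2 * c)\<^sup>2 + (B y * c)\<^sup>2"
      using False s pos by (cases "c = 0") (auto simp: add_nonneg_pos)
    then have "0 < R + (P\<^sup>2 + c\<^sup>2) * B y"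
      using s square by (metis zero_less_mult_pos)
    then have "0 < R / B y + (P\<^sup>2 + c\<^sup>2)"
      using pos by (simp add: field_simps)
    then show ?thesis using bound by simp
  qed
  then show ?thesis
    using fin_A_pos by (simp add: form)
qed

lemma bounded_linear_form: "bounded_linear (fin_form \<alpha> \<beta> g y u)"
proof -
  define X where "X = g / B y * (q y * b u - b y * dq y u)"
  have "fin_form \<alpha> \<beta> g y u =
    (\<lambda>v. (A y *\<^sub>R (X *\<^sub>R ((g * q y) *\<^sub>R \<beta> + \<alpha> *v y) + (g * dq y u) *\<^sub>R \<beta> + \<alpha> *v u)) \<bullet> v)"
  proof
    fix v
    have "u \<bullet> (\<alpha> *v v) = (\<alpha> *v u) \<bullet> v" "v \<bullet> (\<alpha> *v y) = (\<alpha> *v y) \<bullet> v"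
      using symmetric_matrix_inner[OF symmetric, of u v] by (simp_all add: inner_commute)
    then show "fin_form \<alpha> \<beta> g y u v =
      (A y *\<^sub>R (X *\<^sub>R ((g * q y) *\<^sub>R \<beta> + \<alpha> *v y) + (g * dq y u) *\<^sub>R \<beta> + \<alpha> *v u)) \<bullet> v"
      by (simp add: fin_form_def Let_def X_def inner_add_left fin_b_inner)
  qed
  then show ?thesis
    by (simp only: bounded_linear_inner_right)
qed

lemma finsler_metric_form:
  assumes "K x = fin_K \<alpha> \<beta> g" "y \<noteq> 0"
  shows "finsler_metric K x y $ i $ j = fin_form \<alpha> \<beta> g y (axis i 1) (axis j 1)"
proof -
  have inner: "fin_momentum \<alpha> \<beta> g v \<bullet> axis j 1 = 1/2 * pderiv_at j (\<lambda>u. (K x u)\<^sup>2) v" if "v \<noteq> 0" for v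
    unfolding assms(1) using pderiv_at_eq[OF has_derivative_K_squared[OF that]] by simp
  have "((\<lambda>v. 1/2 * pderiv_at j (\<lambda>u. (K x u)\<^sup>2) v) has_derivative
    (\<lambda>v. fin_form \<alpha> \<beta> g y v (axis j 1))) (at y)"
    by (rule has_derivative_transform_within_open[OF has_derivative_momentum[OF assms(2)], of "- {0}"])
      (use inner assms(2) in auto)
  then have "((\<lambda>v. 2 * (1/2 * pderiv_at j (\<lambda>u. (K x u)\<^sup>2) v)) has_derivative
    (\<lambda>v. 2 * fin_form \<alpha> \<beta> g y v (axis j 1))) (at y)"
    by (intro has_derivative_mult_right)
  then have "((\<lambda>v. pderiv_at j (\<lambda>u. (K x u)\<^sup>2) v) has_derivative
    (\<lambda>v. 2 * fin_form \<alpha> \<beta> g y v (axis j 1))) (at y)"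
    by simp
  from pderiv_at_eq[OF this, of i] show ?thesis
    by (simp add: finsler_metric_def)
qed

lemma finsler_metric_mult:
  assumes "K x = fin_K \<alpha> \<beta> g" "y \<noteq> 0"
  shows "(finsler_metric K x y *v v) $ i = fin_form \<alpha> \<beta> g y (axis i 1) v"
  using sum_scaled_axis[OF bounded_linear_form[of y "axis i 1"], of v]
  by (simp add: matrix_vector_mult_def finsler_metric_form[of K x, OF assms] mult.commute)

lemma finsler_metric_invertible:
  assumes "K x = fin_K \<alpha> \<beta> g" "y \<noteq> 0"
  shows "invertible (finsler_metric K x y)"
proof (rule positive_definite_invertible)
  fix v :: "real^'n" assume "v \<noteq> 0"
  have "v \<bullet> (finsler_metric K x y *v v) = (\<Sum>i\<in>UNIV. v $ i * fin_form \<alpha> \<beta> g y v (axis i 1))"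
    by (simp add: inner_vec_def finsler_metric_mult[of K x, OF assms] form_commute[OF assms(2), of _ v])
  also have "\<dots> = fin_form \<alpha> \<beta> g y v v"
    by (rule sum_scaled_axis[OF bounded_linear_form])
  finally show "0 < v \<bullet> (finsler_metric K x y *v v)"
    using form_positive[OF assms(2) \<open>v \<noteq> 0\<close>] by simp
qed

end

section \<open>Lowering the spray coefficients\<close>

text \<open>In this form the lemma applies to the Finslerian and to the Riemannian Christoffel symbols.\<close>

lemma matrix_mult_christoffel:
  fixes M :: "real^'n^'n::finite"
  assumes "invertible M"
  shows "M *v (\<chi> i. \<Sum>n\<in>UNIV. \<Sum>m\<in>UNIV. (1/2 * (\<Sum>j\<in>UNIV. matrix_inv M $ i $ j * C j n m)) * y $ n * y $ m)
    = (\<chi> j. 1/2 * (\<Sum>n\<in>UNIV. \<Sum>m\<in>UNIV. C j n m * y $ n * y $ m))"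
proof -
  have "(\<chi> i. \<Sum>n\<in>UNIV. \<Sum>m\<in>UNIV. (1/2 * (\<Sum>j\<in>UNIV. matrix_inv M $ i $ j * C j n m)) * y $ n * y $ m)
    = matrix_inv M *v (\<chi> j. 1/2 * (\<Sum>n\<in>UNIV. \<Sum>m\<in>UNIV. C j n m * y $ n * y $ m))"
  proof (simp add: vec_eq_iff matrix_vector_mult_def, intro allI)
    fix i
    have "(\<Sum>n\<in>UNIV. \<Sum>m\<in>UNIV. (\<Sum>j\<in>UNIV. matrix_inv M $ i $ j * C j n m) * y $ n * y $ m / 2)
      = (\<Sum>n\<in>UNIV. \<Sum>m\<in>UNIV. \<Sum>j\<in>UNIV. matrix_inv M $ i $ j * (C j n m * y $ n * y $ m) / 2)"
      by (simp add: sum_distrib_left sum_distrib_right sum_divide_distrib mult_ac)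
    also have "\<dots> = (\<Sum>n\<in>UNIV. \<Sum>j\<in>UNIV. \<Sum>m\<in>UNIV. matrix_inv M $ i $ j * (C j n m * y $ n * y $ m) / 2)"
      by (intro sum.cong refl sum.swap)
    also have "\<dots> = (\<Sum>j\<in>UNIV. \<Sum>n\<in>UNIV. \<Sum>m\<in>UNIV. matrix_inv M $ i $ j * (C j n m * y $ n * y $ m) / 2)"
      by (rule sum.swap)
    also have "\<dots> = (\<Sum>j\<in>UNIV. matrix_inv M $ i $ j * (\<Sum>n\<in>UNIV. \<Sum>m\<in>UNIV. C j n m * y $ n * y $ m) / 2)"
      by (simp add: sum_distrib_left sum_divide_distrib)
    finally show "(\<Sum>n\<in>UNIV. \<Sum>m\<in>UNIV. (\<Sum>j\<in>UNIV. matrix_inv M $ i $ j * C j n m) * y $ n * y $ m / 2)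
      = (\<Sum>j\<in>UNIV. matrix_inv M $ i $ j * (\<Sum>n\<in>UNIV. \<Sum>m\<in>UNIV. C j n m * y $ n * y $ m) / 2)" .
  qed
  then show ?thesis
    by (simp only: matrix_mult_inv_vector[OF assms])
qed

text \<open>Here \<open>D i j\<close> is the derivative of the \<open>(i, j)\<close> component of a metric, and \<open>E n m\<close> stands for the
  derivative of its \<open>(n, m)\<close> component in the direction of the \<open>j\<close>-th coordinate.\<close>

lemma sum_christoffel_lowered:
  fixes D :: "'n::finite \<Rightarrow> 'n \<Rightarrow> real^'n \<Rightarrow> real"
  assumes "\<And>i j. bounded_linear (D i j)"
  shows "1/2 * (\<Sum>n\<in>UNIV. \<Sum>m\<in>UNIV. (D j n (axis m 1) + D j m (axis n 1) - E n m) * y $ n * y $ m)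
    = (\<Sum>n\<in>UNIV. y $ n * D j n y) - 1/2 * (\<Sum>n\<in>UNIV. \<Sum>m\<in>UNIV. y $ n * y $ m * E n m)"
proof -
  have 1: "(\<Sum>n\<in>UNIV. \<Sum>m\<in>UNIV. y $ n * (y $ m * D j n (axis m 1))) = (\<Sum>n\<in>UNIV. y $ n * D j n y)"
    by (simp add: sum_distrib_left[symmetric] sum_scaled_axis[OF assms])
  then have 2: "(\<Sum>n\<in>UNIV. \<Sum>m\<in>UNIV. y $ m * (y $ n * D j m (axis n 1))) = (\<Sum>n\<in>UNIV. y $ n * D j n y)"
    by (subst sum.swap)
  have "(\<Sum>n\<in>UNIV. \<Sum>m\<in>UNIV. (D j n (axis m 1) + D j m (axis n 1) - E n m) * y $ n * y $ m)
    = (\<Sum>n\<in>UNIV. \<Sum>m\<in>UNIV. y $ n * (y $ m * D j n (axis m 1)))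
      + (\<Sum>n\<in>UNIV. \<Sum>m\<in>UNIV. y $ m * (y $ n * D j m (axis n 1)))
      - (\<Sum>n\<in>UNIV. \<Sum>m\<in>UNIV. y $ n * y $ m * E n m)"
    by (simp add: sum.distrib[symmetric] sum_subtractf[symmetric] algebra_simps)
  then show ?thesis
    unfolding 1 2 by simp
qed

section \<open>Fields in a coordinate domain\<close>

text \<open>Fields on a coordinate domain \<open>U\<close> that are differentiable at the point \<open>x\<close>; \<open>d\<alpha> v\<close>, \<open>d\<beta> v\<close>,
  \<open>d\<gamma> v\<close> are their derivatives at \<open>x\<close> in the direction \<open>v\<close>.\<close>

locale finsleroid_fields =
  fixes U :: "(real^'n::finite) set"
    and \<alpha> :: "real^'n \<Rightarrow> real^'n^'n" and \<beta> :: "real^'n \<Rightarrow> real^'n" and \<gamma> :: "real^'n \<Rightarrow> real"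
    and x :: "real^'n"
    and d\<alpha> :: "real^'n \<Rightarrow> real^'n^'n" and d\<beta> :: "real^'n \<Rightarrow> real^'n" and d\<gamma> :: "real^'n \<Rightarrow> real"
  assumes open_U: "open U" and x_in_U: "x \<in> U"
    and datum: "\<And>z. z \<in> U \<Longrightarrow> finsleroid_datum (\<alpha> z) (\<beta> z) (\<gamma> z)"
    and has_derivative_\<alpha>: "\<And>i j. ((\<lambda>z. \<alpha> z $ i $ j) has_derivative (\<lambda>v. d\<alpha> v $ i $ j)) (at x)"
    and has_derivative_\<beta>: "\<And>i. ((\<lambda>z. \<beta> z $ i) has_derivative (\<lambda>v. d\<beta> v $ i)) (at x)"
    and has_derivative_\<gamma>: "(\<gamma> has_derivative d\<gamma>) (at x)"
begin

sublocale finsleroid_datum "\<alpha> x" "\<beta> x" "\<gamma> x"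
  by (rule datum[OF x_in_U])

text \<open>The metric function of the fields.\<close>

definition K :: "real^'n \<Rightarrow> real^'n \<Rightarrow> real" where
  "K z = fin_K (\<alpha> z) (\<beta> z) (\<gamma> z)"

abbreviation "w y \<equiv> fin_w (\<gamma> x) (b y) (q y)"

lemma has_derivative_b_x: "((\<lambda>z. fin_b (\<beta> z) y) has_derivative (\<lambda>v. d\<beta> v \<bullet> y)) (at x)"
  unfolding fin_b_def inner_vec_def
  by (intro has_derivative_sum) (auto intro!: derivative_eq_intros has_derivative_\<beta>)

lemma has_derivative_lowered:
  "((\<lambda>z. (\<alpha> z *v y) $ i) has_derivative (\<lambda>v. (d\<alpha> v *v y) $ i)) (at x)"
  unfolding matrix_vector_mult_def vec_lambda_beta
  by (intro has_derivative_sum) (auto intro!: derivative_eq_intros has_derivative_\<alpha>)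

lemma has_derivative_quadratic_form:
  "((\<lambda>z. u \<bullet> (\<alpha> z *v y)) has_derivative (\<lambda>v. u \<bullet> (d\<alpha> v *v y))) (at x)"
  unfolding inner_vec_def
  by (intro has_derivative_sum) (auto intro!: derivative_eq_intros has_derivative_lowered)

lemma d\<alpha>_symmetric: "d\<alpha> v $ i $ j = d\<alpha> v $ j $ i"
proof -
  have "((\<lambda>z. \<alpha> z $ i $ j) has_derivative (\<lambda>v. d\<alpha> v $ j $ i)) (at x)"
  proof (rule has_derivative_transform_within_open[OF has_derivative_\<alpha> open_U x_in_U])
    show "\<alpha> z $ j $ i = \<alpha> z $ i $ j" if "z \<in> U" for z
      using finsleroid_datum.symmetric[OF datum[OF that]] by (metis transpose_def vec_lambda_beta)
  qed
  from has_derivative_unique[OF this has_derivative_\<alpha>] show ?thesis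
    by (simp add: fun_eq_iff)
qed

text \<open>The derivative of \<open>q\<close>, at the fixed vector \<open>y\<close>, in the direction \<open>v\<close> of the coordinate
  space.\<close>

definition dxq :: "real^'n \<Rightarrow> real^'n \<Rightarrow> real" where
  "dxq y v = (y \<bullet> (d\<alpha> v *v y) / 2 - b y * (d\<beta> v \<bullet> y)) / q y"

lemma has_derivative_q_x:
  assumes "y \<noteq> 0"
  shows "((\<lambda>z. fin_q (\<alpha> z) (\<beta> z) y) has_derivative dxq y) (at x)"
proof -
  let ?Q = "\<lambda>z. y \<bullet> (\<alpha> z *v y) - fin_b (\<beta> z) y * fin_b (\<beta> z) y"
  have Q: "sqrt (?Q z) = fin_q (\<alpha> z) (\<beta> z) y" if "z \<in> U" for z
    using finsleroid_datum.q_sqrt[OF datum[OF that], of y] by (simp add: fin_b_inner power2_eq_square)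
  have "(?Q has_derivative (\<lambda>v. y \<bullet> (d\<alpha> v *v y) - (b y * (d\<beta> v \<bullet> y) + (d\<beta> v \<bullet> y) * b y))) (at x)"
    by (intro has_derivative_diff has_derivative_mult has_derivative_quadratic_form has_derivative_b_x)
  moreover have "?Q x > 0"
    using b_squared_less[OF assms] by (simp add: fin_b_inner power2_eq_square)
  ultimately have "((\<lambda>z. sqrt (?Q z)) has_derivative
      (\<lambda>v. (y \<bullet> (d\<alpha> v *v y) - (b y * (d\<beta> v \<bullet> y) + (d\<beta> v \<bullet> y) * b y)) * (inverse (sqrt (?Q x)) / 2))) (at x)"
    by (intro has_derivative_real_sqrt)
  moreover have "(\<lambda>v. (y \<bullet> (d\<alpha> v *v y) - (b y * (d\<beta> v \<bullet> y) + (d\<beta> v \<bullet> y) * b y)) * (inverse (sqrt (?Q x)) / 2)) = dxq y"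
    unfolding Q[OF x_in_U] using q_pos[OF assms] by (simp add: fun_eq_iff dxq_def field_simps)
  ultimately have "((\<lambda>z. sqrt (?Q z)) has_derivative dxq y) (at x)"
    by (simp only:)
  then show ?thesis
    by (rule has_derivative_transform_within_open[OF _ open_U x_in_U]) (rule Q)
qed

lemma has_derivative_A_x:
  assumes "y \<noteq> 0"
  shows "((\<lambda>z. fin_A (\<gamma> z) (fin_b (\<beta> z) y) (fin_q (\<alpha> z) (\<beta> z) y)) has_derivative
    (\<lambda>v. A y * (\<gamma> x / B y * (q y * (d\<beta> v \<bullet> y) - b y * dxq y v) + w y * d\<gamma> v))) (at x)"
  by (rule has_derivative_fin_A[OF has_derivative_\<gamma> has_derivative_b_x has_derivative_q_x[OF assms] open_U x_in_U])
    (use datum finsleroid_datum.charge finsleroid_datum.q_pos[OF _ assms] in blast)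

text \<open>By Euler's identity \<open>momentum_self\<close> the differentiated function is \<open>K\<^sup>2\<close> at the fixed vector
  \<open>y\<close>.\<close>

lemma has_derivative_energy:
  assumes "y \<noteq> 0"
  shows "((\<lambda>z. fin_momentum (\<alpha> z) (\<beta> z) (\<gamma> z) y \<bullet> y) has_derivative
    (\<lambda>v. A y * (2 * \<gamma> x * q y * (d\<beta> v \<bullet> y) + y \<bullet> (d\<alpha> v *v y) + (w y * B y + q y * b y) * d\<gamma> v))) (at x)"
proof -
  let ?b = "\<lambda>z. fin_b (\<beta> z) y" and ?q = "\<lambda>z. fin_q (\<alpha> z) (\<beta> z) y"
  define B' where "B' v = 2 * b y * (d\<beta> v \<bullet> y) + d\<gamma> v * q y * b y + \<gamma> x * dxq y v * b y
      + \<gamma> x * q y * (d\<beta> v \<bullet> y) + 2 * q y * dxq y v" for v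
  have dB: "((\<lambda>z. fin_B (\<gamma> z) (?b z) (?q z)) has_derivative B') (at x)"
    unfolding fin_B_def B'_def
    by (auto intro!: derivative_eq_intros has_derivative_b_x has_derivative_q_x[OF assms] has_derivative_\<gamma>
        simp: fun_eq_iff algebra_simps)
  have eq: "A y * B' v + A y * (\<gamma> x / B y * (q y * (d\<beta> v \<bullet> y) - b y * dxq y v) + w y * d\<gamma> v) * B y
    = A y * (2 * \<gamma> x * q y * (d\<beta> v \<bullet> y) + y \<bullet> (d\<alpha> v *v y) + (w y * B y + q y * b y) * d\<gamma> v)" for v
  proof -
    let ?X = "\<gamma> x / B y * (q y * (d\<beta> v \<bullet> y) - b y * dxq y v) + w y * d\<gamma> v"
    have X: "?X * B y = \<gamma> x * (q y * (d\<beta> v \<bullet> y) - b y * dxq y v) + w y * B y * d\<gamma> v"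
      using B_pos[OF assms] by (simp add: field_simps)
    have S: "y \<bullet> (d\<alpha> v *v y) = 2 * (q y * dxq y v) + 2 * (b y * (d\<beta> v \<bullet> y))"
      using q_pos[OF assms] by (simp add: dxq_def)
    have "A y * B' v + A y * ?X * B y = A y * (B' v + ?X * B y)"
      by (simp only: mult.assoc distrib_left[of "A y" "B' v"])
    also have "\<dots> = A y * (2 * \<gamma> x * q y * (d\<beta> v \<bullet> y) + y \<bullet> (d\<alpha> v *v y) + (w y * B y + q y * b y) * d\<gamma> v)"
      unfolding X S B'_def by (simp add: algebra_simps)
    finally show ?thesis .
  qed
  have "((\<lambda>z. fin_A (\<gamma> z) (?b z) (?q z) * fin_B (\<gamma> z) (?b z) (?q z)) has_derivative
    (\<lambda>v. A y * (2 * \<gamma> x * q y * (d\<beta> v \<bullet> y) + y \<bullet> (d\<alpha> v *v y) + (w y * B y + q y * b y) * d\<gamma> v))) (at x)"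
    using has_derivative_mult[OF has_derivative_A_x[OF assms] dB] unfolding eq .
  then show ?thesis
    by (rule has_derivative_transform_within_open[OF _ open_U x_in_U])
      (simp add: finsleroid_datum.momentum_self[OF datum assms])
qed

lemma has_derivative_momentum_x:
  assumes "y \<noteq> 0"
  shows "((\<lambda>z. fin_momentum (\<alpha> z) (\<beta> z) (\<gamma> z) y $ i) has_derivative
    (\<lambda>v. A y * ((\<gamma> x / B y * (q y * (d\<beta> v \<bullet> y) - b y * dxq y v) + w y * d\<gamma> v)
             * (\<gamma> x * q y * \<beta> x $ i + (\<alpha> x *v y) $ i)
           + (d\<gamma> v * q y + \<gamma> x * dxq y v) * \<beta> x $ i + \<gamma> x * q y * d\<beta> v $ i + (d\<alpha> v *v y) $ i))) (at x)"
  unfolding fin_momentum_def vector_scaleR_component vector_add_component real_scaleR_def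
  by (rule has_derivative_eq_rhs)
    (rule has_derivative_mult[OF has_derivative_A_x[OF assms]
        has_derivative_add[OF has_derivative_mult[OF has_derivative_mult[OF has_derivative_\<gamma>
          has_derivative_q_x[OF assms]] has_derivative_\<beta>] has_derivative_lowered]],
      simp add: fun_eq_iff algebra_simps)

lemma form_differentiable:
  assumes "y \<noteq> 0"
  shows "(\<lambda>z. fin_form (\<alpha> z) (\<beta> z) (\<gamma> z) y u v) differentiable (at x)"
proof -
  have diff: "(\<lambda>z. fin_A (\<gamma> z) (fin_b (\<beta> z) y) (fin_q (\<alpha> z) (\<beta> z) y)) differentiable (at x)"
    "(\<lambda>z. fin_q (\<alpha> z) (\<beta> z) y) differentiable (at x)"
    "\<gamma> differentiable (at x)"
    "\<And>v. (\<lambda>z. fin_b (\<beta> z) v) differentiable (at x)"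
    "\<And>u v. (\<lambda>z. u \<bullet> (\<alpha> z *v v)) differentiable (at x)"
    using has_derivative_A_x[OF assms] has_derivative_q_x[OF assms] has_derivative_\<gamma>
      has_derivative_b_x has_derivative_quadratic_form
    unfolding differentiable_def by blast+
  show ?thesis
    using q_pos[OF assms] B_pos[OF assms]
    unfolding fin_form_def Let_def fin_dq_def fin_B_def
    by (intro differentiable_mult differentiable_add differentiable_diff differentiable_divide
        differentiable_power diff) auto
qed

text \<open>The identity \<open>g\<^sub>i\<^sub>j G\<^sup>j = y\<^sup>m \<partial>\<^sub>m p\<^sub>i - \<partial>\<^sub>i (K\<^sup>2/2)\<close> with both derivatives written out. The
  derivatives of the components \<open>g\<^sub>i\<^sub>j\<close> never have to be computed: only their contractions with \<open>y\<close>
  occur, and these are the derivatives of \<open>p\<^sub>i\<close> and of \<open>K\<^sup>2\<close>.\<close>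

lemma spray_lowered:
  assumes "y \<noteq> 0"
  shows "(finsler_metric K x y *v (\<chi> i. spray K x y i)) $ i
    = A y * ((\<gamma> x / B y * (q y * (d\<beta> y \<bullet> y) - b y * dxq y y) + w y * d\<gamma> y)
             * (\<gamma> x * q y * \<beta> x $ i + (\<alpha> x *v y) $ i)
           + (d\<gamma> y * q y + \<gamma> x * dxq y y) * \<beta> x $ i + \<gamma> x * q y * d\<beta> y $ i + (d\<alpha> y *v y) $ i)
      - 1/2 * (A y * (2 * \<gamma> x * q y * (d\<beta> (axis i 1) \<bullet> y) + y \<bullet> (d\<alpha> (axis i 1) *v y)
           + (w y * B y + q y * b y) * d\<gamma> (axis i 1)))"
proof -
  let ?P = "\<lambda>v. A y * ((\<gamma> x / B y * (q y * (d\<beta> v \<bullet> y) - b y * dxq y v) + w y * d\<gamma> v)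
             * (\<gamma> x * q y * \<beta> x $ i + (\<alpha> x *v y) $ i)
           + (d\<gamma> v * q y + \<gamma> x * dxq y v) * \<beta> x $ i + \<gamma> x * q y * d\<beta> v $ i + (d\<alpha> v *v y) $ i)"
  let ?E = "\<lambda>v. A y * (2 * \<gamma> x * q y * (d\<beta> v \<bullet> y) + y \<bullet> (d\<alpha> v *v y)
           + (w y * B y + q y * b y) * d\<gamma> v)"
  define D where "D i j = frechet_derivative (\<lambda>z. finsler_metric K z y $ i $ j) (at x)" for i j
  have metric: "finsler_metric K z y $ i $ j = fin_form (\<alpha> z) (\<beta> z) (\<gamma> z) y (axis i 1) (axis j 1)"
    "(finsler_metric K z y *v y) $ i = fin_momentum (\<alpha> z) (\<beta> z) (\<gamma> z) y $ i"
    if "z \<in> U" for z i j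
  proof -
    interpret z: finsleroid_datum "\<alpha> z" "\<beta> z" "\<gamma> z" by (rule datum[OF that])
    show "finsler_metric K z y $ i $ j = fin_form (\<alpha> z) (\<beta> z) (\<gamma> z) y (axis i 1) (axis j 1)"
      by (rule z.finsler_metric_form[of K z, OF K_def assms])
    show "(finsler_metric K z y *v y) $ i = fin_momentum (\<alpha> z) (\<beta> z) (\<gamma> z) y $ i"
      using z.finsler_metric_mult[of K z, OF K_def assms]
      by (simp add: z.form_commute[OF assms, of _ y] z.form_self[OF assms] inner_axis)
  qed
  have D: "((\<lambda>z. finsler_metric K z y $ i $ j) has_derivative D i j) (at x)" for i j
  proof -
    obtain F where F: "((\<lambda>z. fin_form (\<alpha> z) (\<beta> z) (\<gamma> z) y (axis i 1) (axis j 1)) has_derivative F) (at x)"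
      using form_differentiable[OF assms] unfolding differentiable_def by blast
    have "((\<lambda>z. finsler_metric K z y $ i $ j) has_derivative F) (at x)"
      by (rule has_derivative_transform_within_open[OF F open_U x_in_U]) (simp add: metric)
    then show ?thesis
      unfolding D_def by (metis differentiableI frechet_derivative_works)
  qed
  have D_momentum: "(\<Sum>n\<in>UNIV. y $ n * D i n v) = ?P v" for v
  proof -
    have "((\<lambda>z. \<Sum>n\<in>UNIV. y $ n * finsler_metric K z y $ i $ n) has_derivative (\<lambda>v. \<Sum>n\<in>UNIV. y $ n * D i n v)) (at x)"
      by (intro has_derivative_sum has_derivative_mult_right D)
    then have "((\<lambda>z. fin_momentum (\<alpha> z) (\<beta> z) (\<gamma> z) y $ i) has_derivative (\<lambda>v. \<Sum>n\<in>UNIV. y $ n * D i n v)) (at x)"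
      by (rule has_derivative_transform_within_open[OF _ open_U x_in_U])
        (simp add: metric(2)[symmetric] matrix_vector_mult_def mult.commute)
    from has_derivative_unique[OF this has_derivative_momentum_x[OF assms]] show ?thesis
      by (rule fun_cong)
  qed
  have D_energy: "(\<Sum>n\<in>UNIV. \<Sum>m\<in>UNIV. y $ n * y $ m * D n m v) = ?E v" for v
  proof -
    have "((\<lambda>z. \<Sum>n\<in>UNIV. \<Sum>m\<in>UNIV. y $ n * y $ m * finsler_metric K z y $ n $ m) has_derivative
      (\<lambda>v. \<Sum>n\<in>UNIV. \<Sum>m\<in>UNIV. y $ n * y $ m * D n m v)) (at x)"
      by (intro has_derivative_sum has_derivative_mult_right D)
    then have "((\<lambda>z. fin_momentum (\<alpha> z) (\<beta> z) (\<gamma> z) y \<bullet> y) has_derivative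
      (\<lambda>v. \<Sum>n\<in>UNIV. \<Sum>m\<in>UNIV. y $ n * y $ m * D n m v)) (at x)"
      by (rule has_derivative_transform_within_open[OF _ open_U x_in_U])
        (simp add: inner_vec_def metric(2)[symmetric] matrix_vector_mult_def sum_distrib_left mult_ac)
    from has_derivative_unique[OF this has_derivative_energy[OF assms]] show ?thesis
      by (rule fun_cong)
  qed
  have "finsler_metric K x y *v (\<chi> i. spray K x y i) = (\<chi> i. 1/2 * (\<Sum>n\<in>UNIV. \<Sum>m\<in>UNIV.
      (D i n (axis m 1) + D i m (axis n 1) - D n m (axis i 1)) * y $ n * y $ m))"
    unfolding spray_def christoffel_F_def pderiv_at_eq[OF D]
    by (rule matrix_mult_christoffel[OF finsler_metric_invertible[of K x, OF K_def assms]])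
  also have "\<dots> = (\<chi> i. (\<Sum>n\<in>UNIV. y $ n * D i n y) - 1/2 * (\<Sum>n\<in>UNIV. \<Sum>m\<in>UNIV. y $ n * y $ m * D n m (axis i 1)))"
    by (subst sum_christoffel_lowered[OF has_derivative_bounded_linear[OF D]]) (rule refl)
  finally show ?thesis
    by (simp only: vec_lambda_beta D_momentum D_energy)
qed

section \<open>Comparison with the Riemannian spray\<close>

text \<open>The spray coefficients of the Riemannian metric \<open>\<alpha>\<close> at \<open>x\<close>.\<close>

definition N :: "real^'n \<Rightarrow> real^'n" where
  "N y = (\<chi> k. \<Sum>n\<in>UNIV. \<Sum>m\<in>UNIV. christoffel_R \<alpha> x k n m * y $ n * y $ m)"

lemma N_lowered: "(\<alpha> x *v N y) $ i = (d\<alpha> y *v y) $ i - 1/2 * (y \<bullet> (d\<alpha> (axis i 1) *v y))"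
proof -
  have quad: "(\<Sum>n\<in>UNIV. \<Sum>m\<in>UNIV. y $ n * y $ m * d\<alpha> v $ m $ n) = y \<bullet> (d\<alpha> v *v y)" for v
    by (subst sum.swap) (simp add: inner_vec_def matrix_vector_mult_def sum_distrib_left mult_ac)
  have "\<alpha> x *v N y = (\<chi> i. 1/2 * (\<Sum>n\<in>UNIV. \<Sum>m\<in>UNIV.
      (d\<alpha> (axis m 1) $ i $ n + d\<alpha> (axis n 1) $ i $ m - d\<alpha> (axis i 1) $ m $ n) * y $ n * y $ m))"
    unfolding N_def christoffel_R_def pderiv_at_eq[OF has_derivative_\<alpha>]
    by (rule matrix_mult_christoffel[OF positive_definite_invertible[OF positive]])
  also have "\<dots> = (\<chi> i. (\<Sum>n\<in>UNIV. y $ n * d\<alpha> y $ i $ n)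
      - 1/2 * (\<Sum>n\<in>UNIV. \<Sum>m\<in>UNIV. y $ n * y $ m * d\<alpha> (axis i 1) $ m $ n))"
    by (subst sum_christoffel_lowered[OF has_derivative_bounded_linear[OF has_derivative_\<alpha>]]) (rule refl)
  finally show ?thesis
    by (simp only: vec_lambda_beta quad) (simp add: matrix_vector_mult_def mult.commute)
qed

lemma inner_N: "y \<bullet> (\<alpha> x *v N y) = 1/2 * (y \<bullet> (d\<alpha> y *v y))"
proof -
  have lin: "bounded_linear (\<lambda>v. y \<bullet> (d\<alpha> v *v y))"
    by (rule has_derivative_bounded_linear[OF has_derivative_quadratic_form])
  have "y \<bullet> (\<alpha> x *v N y) = y \<bullet> (d\<alpha> y *v y) - 1/2 * (\<Sum>i\<in>UNIV. y $ i * (y \<bullet> (d\<alpha> (axis i 1) *v y)))"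
    by (simp add: inner_vec_def[of y "\<alpha> x *v N y"] N_lowered right_diff_distrib sum_subtractf
        sum_divide_distrib inner_vec_def[of y "d\<alpha> y *v y"])
  then show ?thesis
    unfolding sum_scaled_axis[OF lin] by simp
qed

text \<open>The contractions \<open>\<nabla>\<^sub>m b\<^sub>n y\<^sup>m y\<^sup>n\<close> and \<open>y\<^sup>m (\<nabla>\<^sub>m b\<^sub>i - \<nabla>\<^sub>i b\<^sub>m)\<close>, which depend on the
  symmetric and on the skew part of \<open>\<nabla>b\<close>, respectively.\<close>

definition nabla_sym :: "real^'n \<Rightarrow> real" where
  "nabla_sym y = (\<Sum>m\<in>UNIV. \<Sum>n\<in>UNIV. nabla \<alpha> \<beta> x m n * y $ m * y $ n)"

definition nabla_skew :: "real^'n \<Rightarrow> real^'n" where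
  "nabla_skew y = (\<chi> i. \<Sum>m\<in>UNIV. y $ m * (nabla \<alpha> \<beta> x m i - nabla \<alpha> \<beta> x i m))"

lemma bounded_linear_d\<beta>: "bounded_linear (\<lambda>v. d\<beta> v $ i)"
  by (rule has_derivative_bounded_linear[OF has_derivative_\<beta>])

lemma nabla_eq:
  "nabla \<alpha> \<beta> x m n = d\<beta> (axis m 1) $ n - (\<Sum>k\<in>UNIV. \<beta> x $ k * christoffel_R \<alpha> x k m n)"
  by (simp add: nabla_def pderiv_at_eq[OF has_derivative_\<beta>])

lemma christoffel_R_commute: "christoffel_R \<alpha> x k m n = christoffel_R \<alpha> x k n m"
  unfolding christoffel_R_def pderiv_at_eq[OF has_derivative_\<alpha>]
  by (simp add: d\<alpha>_symmetric[of _ n m] add.commute)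

lemma nabla_sym_eq: "d\<beta> y \<bullet> y = nabla_sym y + b (N y)"
proof -
  have "(\<Sum>m\<in>UNIV. \<Sum>n\<in>UNIV. (\<Sum>k\<in>UNIV. \<beta> x $ k * christoffel_R \<alpha> x k m n) * y $ m * y $ n)
    = (\<Sum>m\<in>UNIV. \<Sum>n\<in>UNIV. \<Sum>k\<in>UNIV. \<beta> x $ k * (christoffel_R \<alpha> x k m n * y $ m * y $ n))"
    by (simp add: sum_distrib_left sum_distrib_right mult_ac)
  also have "\<dots> = (\<Sum>m\<in>UNIV. \<Sum>k\<in>UNIV. \<Sum>n\<in>UNIV. \<beta> x $ k * (christoffel_R \<alpha> x k m n * y $ m * y $ n))"
    by (intro sum.cong refl sum.swap)
  also have "\<dots> = (\<Sum>k\<in>UNIV. \<Sum>m\<in>UNIV. \<Sum>n\<in>UNIV. \<beta> x $ k * (christoffel_R \<alpha> x k m n * y $ m * y $ n))"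
    by (rule sum.swap)
  also have "\<dots> = b (N y)"
    by (simp add: fin_b_def N_def sum_distrib_left)
  finally have 1: "(\<Sum>m\<in>UNIV. \<Sum>n\<in>UNIV. (\<Sum>k\<in>UNIV. \<beta> x $ k * christoffel_R \<alpha> x k m n) * y $ m * y $ n) = b (N y)" .
  have "(\<Sum>m\<in>UNIV. \<Sum>n\<in>UNIV. d\<beta> (axis m 1) $ n * y $ m * y $ n)
    = (\<Sum>n\<in>UNIV. y $ n * (\<Sum>m\<in>UNIV. y $ m * d\<beta> (axis m 1) $ n))"
    by (subst sum.swap) (simp add: sum_distrib_left mult_ac)
  also have "\<dots> = d\<beta> y \<bullet> y"
    by (simp add: sum_scaled_axis[OF bounded_linear_d\<beta>] inner_vec_def mult.commute)
  finally have 2: "(\<Sum>m\<in>UNIV. \<Sum>n\<in>UNIV. d\<beta> (axis m 1) $ n * y $ m * y $ n) = d\<beta> y \<bullet> y" .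
  show ?thesis
    by (simp add: nabla_sym_def nabla_eq left_diff_distrib sum_subtractf 1 2)
qed

lemma nabla_skew_eq: "nabla_skew y $ i = d\<beta> y $ i - d\<beta> (axis i 1) \<bullet> y"
proof -
  have "nabla_skew y $ i = (\<Sum>m\<in>UNIV. y $ m * d\<beta> (axis m 1) $ i) - (\<Sum>m\<in>UNIV. y $ m * d\<beta> (axis i 1) $ m)"
    by (simp add: nabla_skew_def nabla_eq christoffel_R_commute[of _ i] sum_subtractf right_diff_distrib)
  then show ?thesis
    by (simp add: sum_scaled_axis[OF bounded_linear_d\<beta>] inner_vec_def mult.commute)
qed

lemma inner_nabla_skew: "y \<bullet> nabla_skew y = 0"
proof -
  have "bounded_linear (\<lambda>v. d\<beta> v \<bullet> y)"
    by (rule has_derivative_bounded_linear[OF has_derivative_b_x])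
  from sum_scaled_axis[OF this, of y] show ?thesis
    by (simp add: inner_vec_def[of y "nabla_skew y"] nabla_skew_eq right_diff_distrib sum_subtractf)
      (simp add: inner_vec_def mult.commute)
qed

text \<open>Every term on the right contains \<open>\<nabla>b\<close> or the derivative of the charge.\<close>

lemma spray_difference:
  assumes "y \<noteq> 0"
  shows "(finsler_metric K x y *v ((\<chi> i. spray K x y i) - N y)) $ i
    = A y * ((\<gamma> x / B y * (q y + (b y)\<^sup>2 / q y) * nabla_sym y + w y * d\<gamma> y)
             * (\<gamma> x * q y * \<beta> x $ i + (\<alpha> x *v y) $ i)
           + (d\<gamma> y * q y - \<gamma> x * b y / q y * nabla_sym y) * \<beta> x $ i
           + \<gamma> x * q y * nabla_skew y $ i
           - (w y * B y + q y * b y) / 2 * d\<gamma> (axis i 1))"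
proof -
  define s where "s = nabla_sym y"
  define Y where "Y = \<gamma> x * q y * \<beta> x $ i + (\<alpha> x *v y) $ i"
  define Z where "Z = y \<bullet> (d\<alpha> (axis i 1) *v y)"
  have q: "q y > 0" using q_pos[OF assms] .
  have b1: "d\<beta> y \<bullet> y = s + b (N y)"
    by (simp add: nabla_sym_eq s_def)
  have "y \<bullet> (d\<alpha> y *v y) = 2 * (N y \<bullet> (\<alpha> x *v y))"
    using inner_N[of y] symmetric_matrix_inner[OF symmetric, of y "N y"] by simp
  then have q1: "dxq y y = dq y (N y) - b y * s / q y"
    by (simp add: dxq_def fin_dq_def b1 distrib_left add_divide_distrib diff_divide_distrib)
  have "(finsler_metric K x y *v N y) $ i = fin_form (\<alpha> x) (\<beta> x) (\<gamma> x) y (N y) (axis i 1)"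
    using form_commute[OF assms, of "axis i 1" "N y"]
    by (simp add: finsler_metric_mult[of K x, OF K_def assms])
  then have form: "(finsler_metric K x y *v N y) $ i
    = A y * (\<gamma> x / B y * (q y * b (N y) - b y * dq y (N y)) * Y
      + \<gamma> x * dq y (N y) * \<beta> x $ i + (d\<alpha> y *v y) $ i - Z / 2)"
    using N_lowered[of y i] symmetric_matrix_inner[OF symmetric, of "N y" "axis i 1"]
    by (simp add: fin_form_def Let_def fin_b_inner Y_def Z_def inner_axis inner_axis')
  have quot: "\<gamma> x / B y * (q y * (s + b (N y)) - b y * (dq y (N y) - b y * s / q y))
    = \<gamma> x / B y * (q y * b (N y) - b y * dq y (N y)) + \<gamma> x / B y * (q y + (b y)\<^sup>2 / q y) * s"
    by (simp add: algebra_simps power2_eq_square)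
  show ?thesis
    unfolding matrix_vector_mult_diff_distrib vector_minus_component form spray_lowered[OF assms]
      nabla_skew_eq s_def[symmetric] Y_def[symmetric] Z_def[symmetric] b1 q1 quot
    by (simp add: algebra_simps)
qed

lemma spray_difference_inner:
  assumes "y \<noteq> 0"
  shows "y \<bullet> (finsler_metric K x y *v ((\<chi> i. spray K x y i) - N y))
    = A y * (\<gamma> x * q y * nabla_sym y + (w y * B y + q y * b y) / 2 * d\<gamma> y)"
proof -
  define c1 c2 c3 where "c1 = \<gamma> x / B y * (q y + (b y)\<^sup>2 / q y) * nabla_sym y + w y * d\<gamma> y"
    and "c2 = d\<gamma> y * q y - \<gamma> x * b y / q y * nabla_sym y" and "c3 = (w y * B y + q y * b y) / 2"
  have d\<gamma>: "(\<Sum>i\<in>UNIV. y $ i * d\<gamma> (axis i 1)) = d\<gamma> y"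
    by (rule sum_scaled_axis[OF has_derivative_bounded_linear[OF has_derivative_\<gamma>]])
  have "y \<bullet> (finsler_metric K x y *v ((\<chi> i. spray K x y i) - N y))
    = y \<bullet> (A y *\<^sub>R (c1 *\<^sub>R ((\<gamma> x * q y) *\<^sub>R \<beta> x + \<alpha> x *v y) + c2 *\<^sub>R \<beta> x
        + (\<gamma> x * q y) *\<^sub>R nabla_skew y - c3 *\<^sub>R (\<chi> i. d\<gamma> (axis i 1))))"
    by (rule arg_cong[where f = "inner y"])
      (simp add: vec_eq_iff spray_difference[OF assms] c1_def c2_def c3_def)
  also have "\<dots> = A y * (c1 * (\<gamma> x * q y * b y + y \<bullet> (\<alpha> x *v y)) + c2 * b y - c3 * d\<gamma> y)"
    using d\<gamma> by (simp add: inner_add_right inner_diff_right inner_nabla_skew fin_b_inner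
        inner_commute[of y "\<beta> x"]) (simp add: inner_vec_def)
  also have "\<gamma> x * q y * b y + y \<bullet> (\<alpha> x *v y) = B y"
    using q_squared[of y] by (simp add: fin_B_def)
  also have "c1 * B y + c2 * b y = \<gamma> x * q y * nabla_sym y + 2 * c3 * d\<gamma> y"
    using q_pos[OF assms] B_pos[OF assms]
    by (simp add: c1_def c2_def c3_def field_simps power2_eq_square)
  finally show ?thesis
    unfolding c3_def[symmetric] by (simp add: algebra_simps)
qed

lemma nabla_sym_minus: "nabla_sym (- y) = nabla_sym y"
  by (simp add: nabla_sym_def)

text \<open>The equivalence at a single point.\<close>

lemma spray_eq_iff:
  assumes "\<gamma> x \<noteq> 0"
  shows "(\<forall>y. y \<noteq> 0 \<longrightarrow> (\<forall>i. spray K x y i = N y $ i)) \<longleftrightarrow>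
    (\<forall>i. d\<gamma> (axis i 1) = 0) \<and> (\<forall>m n. nabla \<alpha> \<beta> x m n = 0)"
proof
  assume eq: "\<forall>y. y \<noteq> 0 \<longrightarrow> (\<forall>i. spray K x y i = N y $ i)"
  then have diff: "(\<chi> i. spray K x y i) - N y = 0" if "y \<noteq> 0" for y
    using that by (simp add: vec_eq_iff)
  define P where "P y = w y * B y + q y * b y" for y
  have P: "P y < 0" if "y \<noteq> 0" for y
    unfolding P_def by (rule fin_w_negative[OF charge q_pos[OF that]])
  have contracted: "\<gamma> x * q y * nabla_sym y + P y / 2 * d\<gamma> y = 0" if "y \<noteq> 0" for y
    using spray_difference_inner[OF that] diff[OF that] fin_A_pos[of "\<gamma> x" "b y" "q y"]
    by (simp add: P_def)
  have lin: "linear d\<gamma>"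
    by (rule has_derivative_linear[OF has_derivative_\<gamma>])
  \<comment> \<open>\<open>d\<gamma>\<close> is odd in \<open>y\<close>, \<open>q\<close> and \<open>nabla_sym\<close> are even, and \<open>P\<close> has a constant sign\<close>
  have d\<gamma>: "d\<gamma> y = 0" if "y \<noteq> 0" for y
  proof -
    have "\<gamma> x * q y * nabla_sym y + P (- y) / 2 * (- d\<gamma> y) = 0"
      using contracted[of "- y"] that by (simp add: reverse_direction nabla_sym_minus linear_neg[OF lin])
    then have "(P y + P (- y)) * d\<gamma> y = 0"
      using contracted[OF that] by (simp add: algebra_simps)
    moreover have "P y + P (- y) < 0"
      using P[of y] P[of "- y"] that by simp
    ultimately show ?thesis by simp
  qed
  have sym: "nabla_sym y = 0" if "y \<noteq> 0" for y
    using contracted[OF that] d\<gamma>[OF that] q_pos[OF that] assms by simp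
  have skew: "nabla_skew y $ i = 0" if "y \<noteq> 0" for y i
  proof -
    have "d\<gamma> (axis i 1) = 0"
      by (rule d\<gamma>) (simp add: axis_eq_0_iff)
    then show ?thesis
      using spray_difference[OF that, of i] diff[OF that] sym[OF that] d\<gamma>[OF that] q_pos[OF that] assms
        fin_A_pos[of "\<gamma> x" "b y" "q y"] by simp
  qed
  have axis: "axis m 1 \<noteq> (0 :: real^'n)" for m
    by (simp add: axis_eq_0_iff)
  have commute: "nabla \<alpha> \<beta> x m n = nabla \<alpha> \<beta> x n m" for m n
    using skew[OF axis, of m n]
    by (simp add: nabla_skew_def axis_def if_distrib[of "\<lambda>t. t * _"] cong: if_cong)
  have diag: "nabla \<alpha> \<beta> x m m = 0" for m
    using sym[OF axis, of m]
    by (simp add: nabla_sym_def axis_def if_distrib[of "\<lambda>t. t * _"] if_distrib[of "\<lambda>t. _ * t"] cong: if_cong)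
  have "nabla \<alpha> \<beta> x m n = 0" for m n
  proof (cases "m = n")
    case False
    \<comment> \<open>polarization: evaluate the vanishing quadratic form at the sum of two basis vectors\<close>
    have form: "nabla_sym y = (\<Sum>m\<in>UNIV. y $ m * (\<Sum>n\<in>UNIV. y $ n * nabla \<alpha> \<beta> x m n))" for y
      by (simp add: nabla_sym_def sum_distrib_left mult_ac)
    have pick: "(\<Sum>k\<in>UNIV. (axis m 1 + axis n 1 :: real^'n) $ k * F k) = F m + F n" for F :: "'n \<Rightarrow> real"
      by (simp add: axis_def distrib_right sum.distrib if_distrib[of "\<lambda>t. t * _"] cong: if_cong)
    have "(axis m 1 + axis n 1 :: real^'n) $ m = 1"
      using False by (simp add: axis_def)
    then have "axis m 1 + axis n 1 \<noteq> (0 :: real^'n)"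
      by (metis zero_index zero_neq_one)
    from sym[OF this] show ?thesis
      unfolding form pick using diag commute[of m n] by simp
  qed (simp add: diag)
  then show "(\<forall>i. d\<gamma> (axis i 1) = 0) \<and> (\<forall>m n. nabla \<alpha> \<beta> x m n = 0)"
    using d\<gamma> by (simp add: axis_eq_0_iff)
next
  assume flat: "(\<forall>i. d\<gamma> (axis i 1) = 0) \<and> (\<forall>m n. nabla \<alpha> \<beta> x m n = 0)"
  show "\<forall>y. y \<noteq> 0 \<longrightarrow> (\<forall>i. spray K x y i = N y $ i)"
  proof (intro allI impI)
    fix y :: "real^'n" and i
    assume y: "y \<noteq> 0"
    let ?M = "finsler_metric K x y" and ?d = "(\<chi> i. spray K x y i) - N y"
    have "d\<gamma> y = 0"
      using sum_scaled_axis[OF has_derivative_bounded_linear[OF has_derivative_\<gamma>], of y] flat by simp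
    then have "?M *v ?d = 0"
      using flat by (simp add: vec_eq_iff spray_difference[OF y] nabla_sym_def nabla_skew_def)
    then have "matrix_inv ?M *v (?M *v ?d) = 0"
      by simp
    then have "?d = 0"
      using matrix_inv_invertible(2)[OF finsler_metric_invertible[of K x, OF K_def y]]
      by (simp only: matrix_vector_mul_assoc matrix_vector_mul_lid)
    then show "spray K x y i = N y $ i"
      by (simp add: vec_eq_iff)
  qed
qed

end

section \<open>The manifold\<close>

lemma smooth_on_has_derivative:
  assumes "smooth_on U F" "x \<in> U"
  shows "(F has_derivative frechet_derivative F (at x)) (at x)"
proof -
  have "C_k_on (Suc 0) F U"
    using assms(1) unfolding smooth_on_def by blast
  then show ?thesis
    using assms(2) frechet_derivative_works by auto
qed

theorem theorem2:
  fixes X :: "'p topology" and A :: "('p, 'n::finite) chart set"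
    and a :: "('p, 'n) chart \<Rightarrow> real^'n \<Rightarrow> real^'n^'n"
    and b :: "('p, 'n) chart \<Rightarrow> real^'n \<Rightarrow> real^'n"
    and g :: "'p \<Rightarrow> real"
  assumes space: "finsleroid_regular_space X A a b g"
    and g_nonzero: "\<And>p. p \<in> topspace X \<Longrightarrow> g p \<noteq> 0"
  shows "(\<forall>c\<in>A. \<forall>x\<in>crange c. \<forall>y. y \<noteq> 0 \<longrightarrow>
            (\<forall>i. spray (finsleroid_K a b g c) x y i =
                 (\<Sum>n\<in>UNIV. \<Sum>m\<in>UNIV. christoffel_R (a c) x i n m * y $ n * y $ m)))
         \<longleftrightarrow>
         (\<forall>c\<in>A. \<forall>x\<in>crange c. \<forall>i. pderiv_at i (g \<circ> cpoint c) x = 0) \<and>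
         (\<forall>c\<in>A. \<forall>x\<in>crange c. \<forall>m n. nabla (a c) (b c) x m n = 0)"
proof -
  interpret finsleroid_regular_space X A a b g by (rule space)
  have point: "cpoint c x \<in> topspace X" if "c \<in> A" "x \<in> crange c" for c x
  proof -
    have "cpoint c x \<in> cdom c"
      using that(2) unfolding cpoint_def crange_def by (rule inv_into_into)
    then show ?thesis
      using chart_open[OF that(1)] openin_subset by blast
  qed
  have "(\<forall>y. y \<noteq> 0 \<longrightarrow> (\<forall>i. spray (finsleroid_K a b g c) x y i =
        (\<Sum>n\<in>UNIV. \<Sum>m\<in>UNIV. christoffel_R (a c) x i n m * y $ n * y $ m)))
      \<longleftrightarrow> (\<forall>i. pderiv_at i (g \<circ> cpoint c) x = 0) \<and> (\<forall>m n. nabla (a c) (b c) x m n = 0)"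
    if c: "c \<in> A" and x: "x \<in> crange c" for c x
  proof -
    interpret finsleroid_fields "crange c" "a c" "b c" "g \<circ> cpoint c" x
      "\<lambda>v. \<chi> i j. frechet_derivative (\<lambda>z. a c z $ i $ j) (at x) v"
      "\<lambda>v. \<chi> i. frechet_derivative (\<lambda>z. b c z $ i) (at x) v"
      "frechet_derivative (g \<circ> cpoint c) (at x)"
    proof (rule finsleroid_fields.intro)
      show "open (crange c)" "x \<in> crange c"
        using chart_open[OF c] x by auto
      show "finsleroid_datum (a c z) (b c z) ((g \<circ> cpoint c) z)" if "z \<in> crange c" for z
        by standard (use a_symmetric[OF c that] a_positive[OF c that] b_norm[OF c that] g_range[OF point[OF c that]] in auto)
      show "((\<lambda>z. a c z $ i $ j) has_derivative
          (\<lambda>v. (\<chi> i j. frechet_derivative (\<lambda>z. a c z $ i $ j) (at x) v) $ i $ j)) (at x)" for i j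
        using smooth_on_has_derivative[OF a_smooth[OF c] x] by simp
      show "((\<lambda>z. b c z $ i) has_derivative
          (\<lambda>v. (\<chi> i. frechet_derivative (\<lambda>z. b c z $ i) (at x) v) $ i)) (at x)" for i
        using smooth_on_has_derivative[OF b_smooth[OF c] x] by simp
      show "(g \<circ> cpoint c has_derivative frechet_derivative (g \<circ> cpoint c) (at x)) (at x)"
        by (rule smooth_on_has_derivative[OF g_smooth[OF c] x])
    qed
    have "K = finsleroid_K a b g c"
      by (simp add: fun_eq_iff K_def finsleroid_K_def)
    then show ?thesis
      using spray_eq_iff g_nonzero[OF point[OF c x]]
      by (simp add: N_def pderiv_at_eq[OF has_derivative_\<gamma>])
  qed
  then show ?thesis by blast
qed

end
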